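(* For estimating the $\ell_1$ distance $\|P-Q\|_1$ between two unknown distributions $P,Q$ on $\{1,\dots,d\}$ to within additive error $\varepsilon$, the quantum query complexity (in the purified quantum query access model) is $\Omega\!\left(\frac{\sqrt{d}}{\varepsilon\sqrt{\log(d/\varepsilon)}}\right)$.
   Context: Purified quantum query access to a distribution $P=(p_1,\dots,p_d)$: a unitary $U$ on two registers $\mathsf{A},\mathsf{B}$ with $U\ket{0}_{\mathsf A}\ket{0}_{\mathsf B}=\sum_{i=1}^d\sqrt{p_i}\ket{i}_{\mathsf A}\ket{\psi_i}_{\mathsf B}$ for some orthonormal set $\{\ket{\psi_i}\}$; one query means one application of $U$, $U^\dagger$, controlled-$U$ or controlled-$U^\dagger$. In the distance estimation task one is given such oracles for both $P$ and $Q$ and must output an estimate within additive error $\varepsilon$ of $\|P-Q\|_1=\sum_i|p_i-q_i|$ with probability at least $2/3$. The query complexity is the minimum total number of queries needed. *)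

theory Defs
  imports Complex_Main
begin

type_synonym cvec = "nat \<Rightarrow> complex"
type_synonym cmat = "nat \<Rightarrow> nat \<Rightarrow> complex"

definition mat_apply :: "nat \<Rightarrow> cmat \<Rightarrow> cvec \<Rightarrow> cvec" where
  "mat_apply n M v = (\<lambda>r. \<Sum>s<n. M r s * v s)"

definition adj :: "cmat \<Rightarrow> cmat" where
  "adj M = (\<lambda>r s. cnj (M s r))"

(* M^dagger M = I on C^n (equivalent to unitarity in finite dimension) *)
definition is_unitary :: "nat \<Rightarrow> cmat \<Rightarrow> bool" where
  "is_unitary n M \<longleftrightarrow>
     (\<forall>r<n. \<forall>s<n. (\<Sum>k<n. cnj (M k r) * M k s) = (if r = s then 1 else 0))"

definition basis_vec :: "nat \<Rightarrow> cvec" where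
  "basis_vec i = (\<lambda>r. if r = i then 1 else 0)"

(* probability distribution on {0..<d} (the paper's {1..d}, shifted) *)
definition is_distribution :: "nat \<Rightarrow> (nat \<Rightarrow> real) \<Rightarrow> bool" where
  "is_distribution d p \<longleftrightarrow> (\<forall>i<d. 0 \<le> p i) \<and> (\<Sum>i<d. p i) = 1"

definition l1_dist :: "nat \<Rightarrow> (nat \<Rightarrow> real) \<Rightarrow> (nat \<Rightarrow> real) \<Rightarrow> real" where
  "l1_dist d p q = (\<Sum>i<d. \<bar>p i - q i\<bar>)"

(* Purified query access: U unitary on A (dim d) \<otimes> B (dim m), basis index a*m+b,
   with U|0>_A|0>_B = \<Sum>_i sqrt(p_i) |i>_A |psi_i>_B, {psi_i} orthonormal. *)
definition purified_oracle :: "nat \<Rightarrow> nat \<Rightarrow> (nat \<Rightarrow> real) \<Rightarrow> cmat \<Rightarrow> bool" where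
  "purified_oracle d m p U \<longleftrightarrow> is_unitary (d * m) U \<and>
     (\<exists>\<psi> :: nat \<Rightarrow> nat \<Rightarrow> complex.
        (\<forall>i<d. \<forall>j<d. (\<Sum>b<m. cnj (\<psi> i b) * \<psi> j b) = (if i = j then 1 else 0)) \<and>
        (\<forall>a<d. \<forall>b<m. mat_apply (d * m) U (basis_vec 0) (a * m + b)
                        = complex_of_real (sqrt (p a)) * \<psi> a b))"

(* Full space of an algorithm: A \<otimes> B \<otimes> C \<otimes> W with dims d, m, 2, K;
   basis index ((a*m+b)*2 + c)*K + w.  Register C is the control qubit. *)
definition full_dim :: "nat \<Rightarrow> nat \<Rightarrow> nat \<Rightarrow> nat" where
  "full_dim d m K = d * m * 2 * K"

definition query_op :: "nat \<Rightarrow> bool \<Rightarrow> bool \<Rightarrow> cmat \<Rightarrow> cmat" where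
  "query_op K ctrl dag U = (\<lambda>r s.
     (let Op = (if dag then adj U else U) in
      if r mod K = s mod K \<and> (r div K) mod 2 = (s div K) mod 2 then
        (if \<not> ctrl \<or> (r div K) mod 2 = 1 then Op (r div (2 * K)) (s div (2 * K))
         else (if r div (2 * K) = s div (2 * K) then 1 else 0))
      else 0))"

fun alg_state :: "nat \<Rightarrow> nat \<Rightarrow> nat \<Rightarrow> (nat \<Rightarrow> cmat) \<Rightarrow> (nat \<Rightarrow> bool) \<Rightarrow> (nat \<Rightarrow> bool)
                   \<Rightarrow> (nat \<Rightarrow> bool) \<Rightarrow> cmat \<Rightarrow> cmat \<Rightarrow> nat \<Rightarrow> cvec" where
  "alg_state d m K V which ctrl dag UP UQ 0 =
     mat_apply (full_dim d m K) (V 0) (basis_vec 0)"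
| "alg_state d m K V which ctrl dag UP UQ (Suc j) =
     mat_apply (full_dim d m K) (V (Suc j))
       (mat_apply (full_dim d m K) (query_op K (ctrl j) (dag j) (if which j then UP else UQ))
          (alg_state d m K V which ctrl dag UP UQ j))"

definition success_prob :: "nat \<Rightarrow> nat \<Rightarrow> nat \<Rightarrow> nat \<Rightarrow> (nat \<Rightarrow> cmat) \<Rightarrow> (nat \<Rightarrow> bool)
     \<Rightarrow> (nat \<Rightarrow> bool) \<Rightarrow> (nat \<Rightarrow> bool) \<Rightarrow> (nat \<Rightarrow> real) \<Rightarrow> real
     \<Rightarrow> (nat \<Rightarrow> real) \<Rightarrow> (nat \<Rightarrow> real) \<Rightarrow> cmat \<Rightarrow> cmat \<Rightarrow> real" where
  "success_prob d m K T V which ctrl dag out eps p q UP UQ =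
     (\<Sum>r<full_dim d m K.
        if \<bar>out r - l1_dist d p q\<bar> \<le> eps
        then (cmod (alg_state d m K V which ctrl dag UP UQ T r))\<^sup>2 else 0)"

definition solves_distance_estimation :: "nat \<Rightarrow> nat \<Rightarrow> real \<Rightarrow> nat \<Rightarrow> nat
     \<Rightarrow> (nat \<Rightarrow> cmat) \<Rightarrow> (nat \<Rightarrow> bool) \<Rightarrow> (nat \<Rightarrow> bool) \<Rightarrow> (nat \<Rightarrow> bool)
     \<Rightarrow> (nat \<Rightarrow> real) \<Rightarrow> bool" where
  "solves_distance_estimation d m eps K T V which ctrl dag out \<longleftrightarrow>
     (\<forall>j\<le>T. is_unitary (full_dim d m K) (V j)) \<and>
     (\<forall>p q UP UQ. is_distribution d p \<longrightarrow> is_distribution d q \<longrightarrow>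
        purified_oracle d m p UP \<longrightarrow> purified_oracle d m q UQ \<longrightarrow>
        success_prob d m K T V which ctrl dag out eps p q UP UQ \<ge> 2/3)"

end

theory Submission
  imports Defs "HOL-Complex_Analysis.Complex_Analysis" "HOL-Real_Asymp.Real_Asymp"
begin

text \<open>
  Fix \<open>Q\<close> and let \<open>P\<close> have probabilities proportional to \<open>(N + z\<^sub>i)\<^sup>2\<close>, with \<open>N\<close> of order \<open>1/eps\<close> and
  \<open>z\<^sub>1, z\<^sub>2, \<dots>\<close> independent, each drawn from one of two measures whose moments agree up to order
  about \<open>2 ln d\<close> but which give \<open>\<bar>2 N z + z\<^sup>2\<bar>\<close> expectations differing by at least \<open>N/2\<close>. The distance
  concentrates, so an estimator with error \<open>eps\<close> has to tell the two product measures apart.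

  The oracle for \<open>P\<close> is the Householder reflection along the vector of the \<open>N + z\<^sub>i\<close> together with one large
  dummy coordinate. Its entries are rational in each \<open>z\<^sub>i\<close>, so the acceptance probability continues
  holomorphically to complex \<open>z\<^sub>i\<close>, where one query has norm at most \<open>1 + O(\<bar>z\<^sub>i\<bar> / (N sqrt d))\<close>. With
  \<open>T = O(N sqrt d)\<close> queries the continuation grows so slowly on a disc of radius \<open>O(ln d)\<close> that, by
  Cauchy's estimates and the matching moments, exchanging the law of one \<open>z\<^sub>i\<close> changes the acceptance
  probability by much less than \<open>1/d\<close>; a hybrid argument over the coordinates finishes the proof. This
  gives \<open>T = \<Omega>(sqrt d / eps)\<close>, without the logarithmic factor.
\<close>

section \<open>Norms of states and of query operators\<close>

abbreviation vnorm :: "nat \<Rightarrow> cvec \<Rightarrow> real" where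
  "vnorm n v \<equiv> L2_set (\<lambda>r. cmod (v r)) {..<n}"

text \<open>Oracles continued to complex parameters are no longer unitary, so the growth of states
  is tracked through an operator norm bound \<open>L\<close> per query.\<close>

definition op_bounded :: "nat \<Rightarrow> real \<Rightarrow> cmat \<Rightarrow> bool" where
  "op_bounded n L M \<longleftrightarrow> (\<forall>v. vnorm n (mat_apply n M v) \<le> L * vnorm n v)"

lemma vnorm_power2: "(vnorm n v)\<^sup>2 = (\<Sum>r<n. (cmod (v r))\<^sup>2)"
  unfolding L2_set_def by (simp add: sum_nonneg)

lemma vnorm_add: "vnorm n (\<lambda>r. v r + w r) \<le> vnorm n v + vnorm n w"
  by (rule order_trans[OF L2_set_mono L2_set_triangle_ineq]) (auto simp: norm_triangle_ineq)

lemma vnorm_scale: "vnorm n (\<lambda>r. c * v r) = cmod c * vnorm n v"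
  by (simp add: norm_mult L2_set_right_distrib)

lemma unitary_vnorm:
  assumes "is_unitary n M"
  shows "vnorm n (mat_apply n M v) = vnorm n v"
proof -
  have "complex_of_real (\<Sum>r<n. (cmod (mat_apply n M v r))\<^sup>2)
      = (\<Sum>r<n. (\<Sum>s<n. \<Sum>t<n. (M r s * v s) * (cnj (M r t) * cnj (v t))))"
    by (simp add: complex_norm_square mat_apply_def sum_product del: of_real_power)
  also have "\<dots> = (\<Sum>s<n. \<Sum>t<n. \<Sum>r<n. (M r s * v s) * (cnj (M r t) * cnj (v t)))"
    by (subst sum.swap, rule sum.cong[OF refl], rule sum.swap)
  also have "\<dots> = (\<Sum>s<n. \<Sum>t<n. v s * cnj (v t) * (\<Sum>r<n. cnj (M r t) * M r s))"
    by (simp add: sum_distrib_left mult_ac)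
  also have "\<dots> = (\<Sum>s<n. \<Sum>t<n. if t = s then v s * cnj (v t) else 0)"
    using assms by (intro sum.cong refl) (simp add: is_unitary_def)
  also have "\<dots> = (\<Sum>s<n. v s * cnj (v s))"
    by (intro sum.cong refl) simp
  also have "\<dots> = complex_of_real (\<Sum>r<n. (cmod (v r))\<^sup>2)"
    by (simp add: complex_norm_square del: of_real_power)
  finally have "(\<Sum>r<n. (cmod (mat_apply n M v r))\<^sup>2) = (\<Sum>r<n. (cmod (v r))\<^sup>2)"
    by (simp only: of_real_eq_iff)
  then show ?thesis
    by (simp add: L2_set_def)
qed

lemma op_bounded_unitary:
  assumes "is_unitary n M"
  shows "op_bounded n 1 M"
  by (simp add: op_bounded_def unitary_vnorm[OF assms])

lemma op_bounded_mono: "op_bounded n L M \<Longrightarrow> L \<le> L' \<Longrightarrow> op_bounded n L' M"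
  unfolding op_bounded_def by (meson L2_set_nonneg mult_right_mono order_trans)

lemma sum_lessThan_mult:
  fixes g :: "nat \<Rightarrow> 'a::comm_monoid_add"
  shows "(\<Sum>r<n * k. g r) = (\<Sum>q<n. \<Sum>w<k. g (q * k + w))"
proof -
  have "(\<Sum>r<n * k. g r) = (\<Sum>q<n. sum g {q * k..<q * k + k})"
    by (simp add: sum.nat_group)
  also have "\<dots> = (\<Sum>q<n. \<Sum>w<k. g (q * k + w))"
  proof (rule sum.cong[OF refl])
    fix q
    have "sum g {0 + q * k..<k + q * k} = (\<Sum>w<k. g (w + q * k))"
      unfolding sum.shift_bounds_nat_ivl by (simp add: lessThan_atLeast0)
    then show "sum g {q * k..<q * k + k} = (\<Sum>w<k. g (q * k + w))"
      by (simp add: add.commute)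
  qed
  finally show ?thesis .
qed

lemma sum_register:
  fixes g :: "nat \<Rightarrow> 'a::comm_monoid_add"
  shows "(\<Sum>r<n * 2 * K. g r) = (\<Sum>c<2. \<Sum>w<K. \<Sum>q<n. g ((q * 2 + c) * K + w))"
proof -
  have "(\<Sum>r<n * 2 * K. g r) = (\<Sum>q<n. \<Sum>c<2. \<Sum>w<K. g ((q * 2 + c) * K + w))"
    by (simp only: sum_lessThan_mult)
  also have "\<dots> = (\<Sum>c<2. \<Sum>w<K. \<Sum>q<n. g ((q * 2 + c) * K + w))"
    by (subst sum.swap, rule sum.cong[OF refl], rule sum.swap)
  finally show ?thesis .
qed

lemma register_div_mod:
  assumes "c < 2" "w < (K::nat)"
  shows "((q * 2 + c) * K + w) mod K = w"
    "((q * 2 + c) * K + w) div K mod 2 = c"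
    "((q * 2 + c) * K + w) div (2 * K) = q"
proof -
  have 1: "((q * 2 + c) * K + w) div K = q * 2 + c"
    using assms by simp
  show "((q * 2 + c) * K + w) mod K = w"
    using assms by simp
  show "((q * 2 + c) * K + w) div K mod 2 = c"
    unfolding 1 using assms by simp
  have "((q * 2 + c) * K + w) div (2 * K) = (q * 2 + c) div 2"
    by (subst mult.commute[of 2 K], subst div_mult2_eq, subst 1) (rule refl)
  then show "((q * 2 + c) * K + w) div (2 * K) = q"
    using assms by simp
qed

lemma mat_apply_query_op:
  assumes "c < 2" "w < K" "q < n"
  shows "mat_apply (n * 2 * K) (query_op K ctl False U) v ((q * 2 + c) * K + w) =
    (if \<not> ctl \<or> c = 1 then mat_apply n U (\<lambda>q'. v ((q' * 2 + c) * K + w)) q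
     else v ((q * 2 + c) * K + w))"
proof -
  let ?M = "\<lambda>q'. if \<not> ctl \<or> c = 1 then U q q' else if q = q' then 1 else 0"
  have "mat_apply (n * 2 * K) (query_op K ctl False U) v ((q * 2 + c) * K + w) =
     (\<Sum>c'<2. \<Sum>w'<K. \<Sum>q'<n. if w = w' \<and> c = c' then ?M q' * v ((q' * 2 + c') * K + w') else 0)"
    unfolding mat_apply_def sum_register
    by (intro sum.cong refl)
       (use assms in \<open>simp add: query_op_def register_div_mod Let_def\<close>)
  also have "\<dots> = (\<Sum>c'<2. \<Sum>w'<K. if w = w' then if c = c' then
       (\<Sum>q'<n. ?M q' * v ((q' * 2 + c') * K + w')) else 0 else 0)"
    by (intro sum.cong refl) auto
  also have "\<dots> = (\<Sum>c'<2. if c = c' then (\<Sum>q'<n. ?M q' * v ((q' * 2 + c') * K + w)) else 0)"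
    using assms by (intro sum.cong refl) (simp add: sum.delta')
  also have "\<dots> = (\<Sum>q'<n. ?M q' * v ((q' * 2 + c) * K + w))"
    using assms by (simp add: sum.delta')
  also have "\<dots> = (if \<not> ctl \<or> c = 1 then mat_apply n U (\<lambda>q'. v ((q' * 2 + c) * K + w)) q
     else v ((q * 2 + c) * K + w))"
  proof (cases "\<not> ctl \<or> c = 1")
    case True
    then show ?thesis by (simp add: mat_apply_def)
  next
    case False
    have "(\<Sum>q'<n. ?M q' * v ((q' * 2 + c) * K + w)) =
        (\<Sum>q'<n. if q = q' then v ((q' * 2 + c) * K + w) else 0)"
      using False by (intro sum.cong refl) simp
    then show ?thesis using False assms by simp
  qed
  finally show ?thesis .
qed

lemma op_bounded_query_op:
  assumes "op_bounded n L U" "1 \<le> L"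
  shows "op_bounded (n * 2 * K) L (query_op K ctl False U)"
  unfolding op_bounded_def
proof
  fix v
  let ?A = "mat_apply (n * 2 * K) (query_op K ctl False U) v"
  have "(vnorm (n * 2 * K) ?A)\<^sup>2 = (\<Sum>c<2. \<Sum>w<K. (vnorm n (\<lambda>q. ?A ((q * 2 + c) * K + w)))\<^sup>2)"
    by (simp only: vnorm_power2 sum_register)
  also have "\<dots> \<le> (\<Sum>c<2. \<Sum>w<K. (L * vnorm n (\<lambda>q. v ((q * 2 + c) * K + w)))\<^sup>2)"
  proof (intro sum_mono power_mono L2_set_nonneg)
    fix c w assume "c \<in> {..<2::nat}" "w \<in> {..<K}"
    then have cw: "c < 2" "w < K" by auto
    have "vnorm n (\<lambda>q. ?A ((q * 2 + c) * K + w)) = vnorm n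
       (if \<not> ctl \<or> c = 1 then mat_apply n U (\<lambda>q'. v ((q' * 2 + c) * K + w))
        else (\<lambda>q. v ((q * 2 + c) * K + w)))"
      by (intro L2_set_cong refl) (use cw in \<open>simp add: mat_apply_query_op\<close>)
    also have "\<dots> \<le> L * vnorm n (\<lambda>q. v ((q * 2 + c) * K + w))"
      using assms mult_right_mono[of 1 L "vnorm n (\<lambda>q. v ((q * 2 + c) * K + w))"]
      by (auto simp: op_bounded_def L2_set_nonneg)
    finally show "vnorm n (\<lambda>q. ?A ((q * 2 + c) * K + w)) \<le> L * vnorm n (\<lambda>q. v ((q * 2 + c) * K + w))" .
  qed
  also have "\<dots> = L\<^sup>2 * (\<Sum>c<2. \<Sum>w<K. (vnorm n (\<lambda>q. v ((q * 2 + c) * K + w)))\<^sup>2)"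
    by (simp only: power_mult_distrib sum_distrib_left)
  also have "\<dots> = (L * vnorm (n * 2 * K) v)\<^sup>2"
    by (simp only: vnorm_power2 sum_register power_mult_distrib)
  finally show "vnorm (n * 2 * K) ?A \<le> L * vnorm (n * 2 * K) v"
    by (rule power2_le_imp_le) (use assms in \<open>simp add: L2_set_nonneg\<close>)
qed

lemma vnorm_basis_vec: "vnorm n (basis_vec i) \<le> 1"
proof -
  have "(\<Sum>r<n. (cmod (basis_vec i r))\<^sup>2) = (\<Sum>r<n. if r = i then 1 else 0)"
    by (intro sum.cong) (auto simp: basis_vec_def)
  also have "\<dots> \<le> 1"
    by (auto simp: sum.delta)
  finally show ?thesis
    by (simp add: L2_set_def)
qed

text \<open>Only queries can enlarge the norm, by a factor \<open>L\<close> each, since the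
  interleaved \<open>V j\<close> are unitary.\<close>

lemma vnorm_alg_state:
  assumes "\<And>j. j \<le> T \<Longrightarrow> is_unitary (full_dim d m K) (V j)"
    and "op_bounded (d * m) L UP" "op_bounded (d * m) L UQ" "1 \<le> L"
  shows "vnorm (full_dim d m K) (alg_state d m K V which ctl (\<lambda>_. False) UP UQ T) \<le> L ^ T"
  using assms(1)
proof (induction T)
  case 0
  then show ?case
    by (simp add: unitary_vnorm vnorm_basis_vec)
next
  case (Suc T)
  let ?O = "query_op K (ctl T) False (if which T then UP else UQ)"
  let ?s = "alg_state d m K V which ctl (\<lambda>_. False) UP UQ T"
  have "op_bounded (full_dim d m K) L ?O"
    unfolding full_dim_def using assms by (intro op_bounded_query_op) auto
  then have "vnorm (full_dim d m K) (mat_apply (full_dim d m K) ?O ?s) \<le> L * vnorm (full_dim d m K) ?s"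
    by (simp add: op_bounded_def)
  also have "\<dots> \<le> L * L ^ T"
    using Suc assms(4) by (intro mult_left_mono) auto
  finally show ?case
    using Suc.prems by (simp add: unitary_vnorm)
qed

text \<open>Reflections are their own adjoints, so inverse queries can be treated as forward ones.
  This removes \<open>adj\<close>, whose conjugation would destroy holomorphic dependence on the
  oracle entries.\<close>

lemma alg_state_self_adjoint:
  assumes "adj UP = UP" "adj UQ = UQ"
  shows "alg_state d m K V which ctl dag UP UQ T = alg_state d m K V which ctl (\<lambda>_. False) UP UQ T"
proof (induction T)
  case (Suc T)
  have "query_op K (ctl T) (dag T) (if which T then UP else UQ) =
        query_op K (ctl T) False (if which T then UP else UQ)"
    by (cases "dag T"; cases "which T") (simp_all add: query_op_def assms cong: if_cong)
  then show ?case using Suc by simp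
qed simp

text \<open>Amplitudes are polynomials in the oracle entries, and neither \<open>V\<close> nor
  \<open>UQ\<close> depends on \<open>z\<close>.\<close>

lemma holomorphic_alg_state:
  assumes "\<And>r s. (\<lambda>z. UP z r s) holomorphic_on A"
  shows "(\<lambda>z. alg_state d m K V which ctl (\<lambda>_. False) (UP z) UQ T r) holomorphic_on A"
proof (induction T arbitrary: r)
  case (Suc T)
  have "(\<lambda>z. query_op K (ctl T) False (if which T then UP z else UQ) r s) holomorphic_on A" for r s
  proof (cases "r mod K = s mod K \<and> (r div K) mod 2 = (s div K) mod 2")
    case True
    show ?thesis
      unfolding query_op_def Let_def if_P[OF True]
      by (cases "\<not> ctl T \<or> (r div K) mod 2 = 1"; cases "which T"; cases "r div (2 * K) = s div (2 * K)")
         (simp_all add: assms)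
  next
    case False
    show ?thesis
      unfolding query_op_def Let_def if_not_P[OF False] by simp
  qed
  then show ?case
    unfolding alg_state.simps mat_apply_def
    by (intro holomorphic_intros Suc)
qed simp

section \<open>Householder oracles\<close>

text \<open>Bilinear rather than sesquilinear: without conjugation, the entries of
  \<open>householder n u\<close> remain rational functions of the entries of \<open>u\<close> when
  these become complex. For real \<open>u\<close> the usual reflection results.\<close>

abbreviation vdot :: "nat \<Rightarrow> cvec \<Rightarrow> cvec \<Rightarrow> complex" where
  "vdot n u v \<equiv> \<Sum>r<n. u r * v r"

definition householder :: "nat \<Rightarrow> cvec \<Rightarrow> cmat" where
  "householder n u = (\<lambda>r s. (if r = s then 1 else 0) - 2 * u r * u s / vdot n u u)"

lemma cmod_vdot_le: "cmod (vdot n u v) \<le> vnorm n u * vnorm n v"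
proof -
  have "cmod (vdot n u v) \<le> (\<Sum>r<n. \<bar>cmod (u r)\<bar> * \<bar>cmod (v r)\<bar>)"
    using norm_sum[of "\<lambda>r. u r * v r" "{..<n}"] by (simp add: norm_mult)
  also have "\<dots> \<le> vnorm n u * vnorm n v"
    by (rule L2_set_mult_ineq)
  finally show ?thesis .
qed

lemma mat_apply_householder:
  assumes "r < n"
  shows "mat_apply n (householder n u) v r = v r - 2 * u r * vdot n u v / vdot n u u"
proof -
  have "mat_apply n (householder n u) v r =
      (\<Sum>s<n. (if r = s then v s else 0) - 2 * u r / vdot n u u * (u s * v s))"
    unfolding mat_apply_def householder_def by (intro sum.cong refl) (auto simp: algebra_simps)
  also have "\<dots> = v r - 2 * u r / vdot n u u * vdot n u v"
    using assms by (simp add: sum_subtractf sum_distrib_left)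
  finally show ?thesis by simp
qed

lemma householder_real: "householder n (\<lambda>r. of_real (c r)) = (\<lambda>r s. of_real
    ((if r = s then 1 else 0) - 2 * c r * c s / (\<Sum>k<n. c k * c k)))"
  by (auto simp: householder_def fun_eq_iff)

lemma adj_householder_real: "adj (householder n (\<lambda>r. of_real (c r))) = householder n (\<lambda>r. of_real (c r))"
  unfolding householder_real adj_def by (auto simp: fun_eq_iff)

lemma is_unitary_householder:
  fixes c :: "nat \<Rightarrow> real"
  assumes "(\<Sum>k<n. c k * c k) \<noteq> 0"
  shows "is_unitary n (householder n (\<lambda>r. of_real (c r)))"
  unfolding is_unitary_def
proof (intro allI impI)
  fix r s assume rs: "r < n" "s < n"
  define G where "G = (\<Sum>k<n. c k * c k)"
  have G: "G \<noteq> 0" using assms by (simp add: G_def)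
  let ?h = "\<lambda>r s. (if r = s then 1 else 0) - 2 * c r * c s / G"
  have "(\<Sum>k<n. ?h k r * ?h k s) =
     (\<Sum>k<n. (if k = r then (if r = s then 1 else 0) else 0) - (if k = r then 2 * c r * c s / G else 0)
        - (if k = s then 2 * c r * c s / G else 0) + 4 * c r * c s / G\<^sup>2 * (c k * c k))"
    by (intro sum.cong refl) (auto simp: algebra_simps power2_eq_square)
  also have "\<dots> = (if r = s then 1 else 0) - 2 * c r * c s / G - 2 * c r * c s / G + 4 * c r * c s / G\<^sup>2 * G"
    using rs by (simp add: sum.distrib sum_subtractf sum_distrib_left G_def)
  also have "\<dots> = (if r = s then 1 else 0)"
    using G by (simp add: field_simps power2_eq_square)
  finally have "complex_of_real (\<Sum>k<n. ?h k r * ?h k s) = (if r = s then 1 else 0)"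
    by simp
  then show "(\<Sum>k<n. cnj (householder n (\<lambda>r. of_real (c r)) k r) * householder n (\<lambda>r. of_real (c r)) k s)
      = (if r = s then 1 else 0)"
    unfolding householder_real G_def[symmetric] by simp
qed

text \<open>The denominator \<open>vdot n u u\<close> moves away from \<open>g\<^sup>2\<close> by at
  most 13/36 of it, hence stays nonzero. The reflection along \<open>u\<close> then differs from the
  unitary one along \<open>c\<close> by three small rank-one operators. In the application
  \<open>e\<close> is a single complex coordinate.\<close>

lemma householder_perturbation:
  fixes n :: nat and c :: "nat \<Rightarrow> real" and e :: cvec
  defines "g \<equiv> vnorm n (\<lambda>r. of_real (c r))"
  assumes g: "0 < g" and e: "vnorm n e \<le> \<kappa> * g" and \<kappa>: "0 \<le> \<kappa>" "\<kappa> \<le> 1 / 6"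
  defines "u \<equiv> (\<lambda>r. of_real (c r) + e r)"
  shows "vdot n u u \<noteq> 0" and "op_bounded n (1 + 24 * \<kappa>) (householder n u)"
proof -
  let ?c = "\<lambda>r. complex_of_real (c r)"
  let ?D = "vdot n u u"
  have G: "vdot n ?c ?c = of_real (g\<^sup>2)"
    unfolding g_def vnorm_power2 by (simp add: power2_eq_square)
  have D: "?D = of_real (g\<^sup>2) + (2 * vdot n ?c e + vdot n e e)"
    unfolding G[symmetric] u_def by (simp add: algebra_simps sum.distrib sum_distrib_left)
  have "cmod (?D - of_real (g\<^sup>2)) \<le> 2 * cmod (vdot n ?c e) + cmod (vdot n e e)"
    unfolding D using norm_triangle_ineq[of "2 * vdot n ?c e" "vdot n e e"] by (simp add: norm_mult)
  also have "\<dots> \<le> 2 * (g * vnorm n e) + vnorm n e * vnorm n e"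
    using cmod_vdot_le[of ?c e n] cmod_vdot_le[of e e n] by (simp add: g_def)
  also have "\<dots> \<le> 2 * (g * (\<kappa> * g)) + (\<kappa> * g) * (\<kappa> * g)"
    using e g \<kappa> by (intro add_mono mult_left_mono mult_mono L2_set_nonneg) auto
  also have "\<dots> = (2 + \<kappa>) * \<kappa> * g\<^sup>2"
    by (simp add: algebra_simps power2_eq_square)
  also have "\<dots> \<le> (13 / 6) * \<kappa> * g\<^sup>2"
    using \<kappa> by (intro mult_right_mono) auto
  finally have DG: "cmod (?D - of_real (g\<^sup>2)) \<le> 13 / 6 * \<kappa> * g\<^sup>2" .
  also have "\<dots> \<le> 13 / 36 * g\<^sup>2"
    using \<kappa> by (intro mult_right_mono) auto
  finally have "cmod (?D - of_real (g\<^sup>2)) \<le> 13 / 36 * g\<^sup>2" .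
  moreover have "cmod (of_real (g\<^sup>2)) - cmod ?D \<le> cmod (?D - of_real (g\<^sup>2))"
    by (metis norm_minus_commute norm_triangle_ineq2)
  ultimately have Dlow: "23 / 36 * g\<^sup>2 \<le> cmod ?D"
    by (simp add: norm_power)
  then show D0: "?D \<noteq> 0"
    using g by auto
  have un: "vnorm n u \<le> (1 + \<kappa>) * g"
    using vnorm_add[of ?c e n] e by (simp add: u_def g_def algebra_simps)
  have inv: "cmod (1 / ?D - 1 / of_real (g\<^sup>2)) \<le> 78 / 23 * \<kappa> / g\<^sup>2"
  proof -
    have "1 / ?D - 1 / of_real (g\<^sup>2) = - (?D - of_real (g\<^sup>2)) / (?D * of_real (g\<^sup>2))"
      using D0 g by (simp add: field_simps)
    then have "cmod (1 / ?D - 1 / of_real (g\<^sup>2)) = cmod (?D - of_real (g\<^sup>2)) / (cmod ?D * g\<^sup>2)"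
      by (simp add: norm_divide norm_mult norm_power norm_minus_commute)
    also have "\<dots> \<le> (13 / 6 * \<kappa> * g\<^sup>2) / (23 / 36 * g\<^sup>2 * g\<^sup>2)"
      using DG Dlow g \<kappa> by (intro frac_le mult_right_mono) auto
    also have "\<dots> = 78 / 23 * \<kappa> / g\<^sup>2"
      using g by (simp add: field_simps)
    finally show ?thesis .
  qed
  show "op_bounded n (1 + 24 * \<kappa>) (householder n u)"
    unfolding op_bounded_def
  proof
    fix v
    let ?V = "vnorm n v"
    have uv: "cmod (vdot n u v) \<le> (1 + \<kappa>) * g * ?V"
      using cmod_vdot_le[of u v n] mult_right_mono[OF un, of ?V] by (simp add: L2_set_nonneg)
    have ev: "cmod (vdot n e v) \<le> \<kappa> * g * ?V"
      using cmod_vdot_le[of e v n] mult_right_mono[OF e, of ?V] by (simp add: L2_set_nonneg)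
    have uvsplit: "vdot n u v = vdot n ?c v + vdot n e v"
      by (simp add: u_def algebra_simps sum.distrib)
    \<comment> \<open>Telescoping from \<open>u\<close> to the real vector: first the denominator is
      exchanged, then the left factor \<open>u\<close>, then the vector inside the inner product.
      The corrections are \<open>\<alpha>\<close>, \<open>\<beta>\<close> and
      \<open>\<gamma>\<close> in turn.\<close>
    define \<alpha> where "\<alpha> = -2 * (vdot n u v * (1 / ?D - 1 / of_real (g\<^sup>2)))"
    define \<beta> where "\<beta> = -2 * (vdot n u v / of_real (g\<^sup>2))"
    define \<gamma> where "\<gamma> = -2 * (vdot n e v / of_real (g\<^sup>2))"
    have dec: "mat_apply n (householder n u) v r =
       mat_apply n (householder n ?c) v r + (\<alpha> * u r + (\<beta> * e r + \<gamma> * ?c r))" if "r < n" for r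
    proof -
      have "v r - 2 * u r * X / ?D = v r - 2 * ?c r * Y / H
          + (-2 * (X * (1 / ?D - 1 / H)) * u r + (-2 * (X / H) * e r + -2 * (Z / H) * ?c r))"
        if "X = Y + Z" "H \<noteq> 0" for X Y Z H
        using that D0 by (simp add: u_def field_simps)
      from this[OF uvsplit, of "of_real (g\<^sup>2)"] show ?thesis
        unfolding mat_apply_householder[OF that] G \<alpha>_def \<beta>_def \<gamma>_def using g by simp
    qed
    have "vnorm n (mat_apply n (householder n u) v) =
        vnorm n (\<lambda>r. mat_apply n (householder n ?c) v r + (\<alpha> * u r + (\<beta> * e r + \<gamma> * ?c r)))"
      by (intro L2_set_cong refl) (simp add: dec)
    also have "\<dots> \<le> vnorm n (mat_apply n (householder n ?c) v)
        + (vnorm n (\<lambda>r. \<alpha> * u r) + (vnorm n (\<lambda>r. \<beta> * e r) + vnorm n (\<lambda>r. \<gamma> * ?c r)))"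
      by (intro order_trans[OF vnorm_add] add_left_mono order_refl)
    also have "vnorm n (mat_apply n (householder n ?c) v) = ?V"
    proof (intro unitary_vnorm is_unitary_householder)
      have "complex_of_real (\<Sum>k<n. c k * c k) = of_real (g\<^sup>2)"
        using G by simp
      then show "(\<Sum>k<n. c k * c k) \<noteq> 0"
        using g by (simp only: of_real_eq_iff) simp
    qed
    also have "vnorm n (\<lambda>r. \<alpha> * u r) \<le> 10 * \<kappa> * ?V"
    proof -
      have "vnorm n (\<lambda>r. \<alpha> * u r) = 2 * cmod (vdot n u v) * cmod (1 / ?D - 1 / of_real (g\<^sup>2)) * vnorm n u"
        unfolding vnorm_scale \<alpha>_def by (simp add: norm_mult)
      also have "\<dots> \<le> 2 * ((1 + \<kappa>) * g * ?V) * (78 / 23 * \<kappa> / g\<^sup>2) * ((1 + \<kappa>) * g)"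
        using uv inv un g \<kappa> by (intro mult_mono) (auto simp: L2_set_nonneg)
      also have "\<dots> = (156 / 23 * (1 + \<kappa>)\<^sup>2) * (\<kappa> * ?V)"
        using g by (simp add: field_simps power2_eq_square)
      also have "\<dots> \<le> 10 * (\<kappa> * ?V)"
      proof (intro mult_right_mono)
        have "(1 + \<kappa>)\<^sup>2 \<le> (7 / 6)\<^sup>2" using \<kappa> by (intro power_mono) auto
        then show "156 / 23 * (1 + \<kappa>)\<^sup>2 \<le> 10" by (simp add: power2_eq_square)
      qed (use \<kappa> in \<open>simp add: L2_set_nonneg\<close>)
      finally show ?thesis by simp
    qed
    also have "vnorm n (\<lambda>r. \<beta> * e r) \<le> 7 / 3 * \<kappa> * ?V"
    proof -
      have "vnorm n (\<lambda>r. \<beta> * e r) = 2 * cmod (vdot n u v) / g\<^sup>2 * vnorm n e"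
        unfolding vnorm_scale \<beta>_def by (simp add: norm_mult norm_divide norm_power)
      also have "\<dots> \<le> 2 * ((1 + \<kappa>) * g * ?V) / g\<^sup>2 * (\<kappa> * g)"
        using uv e g \<kappa> by (intro mult_mono divide_right_mono) (auto simp: L2_set_nonneg)
      also have "\<dots> = (2 * (1 + \<kappa>)) * (\<kappa> * ?V)"
        using g by (simp add: field_simps power2_eq_square)
      also have "\<dots> \<le> 7 / 3 * (\<kappa> * ?V)"
        using \<kappa> by (intro mult_right_mono) (auto simp: L2_set_nonneg)
      finally show ?thesis by simp
    qed
    also have "vnorm n (\<lambda>r. \<gamma> * ?c r) \<le> 2 * \<kappa> * ?V"
    proof -
      have "vnorm n (\<lambda>r. \<gamma> * ?c r) = 2 * cmod (vdot n e v) / g\<^sup>2 * g"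
        unfolding vnorm_scale \<gamma>_def by (simp add: norm_mult norm_divide norm_power g_def)
      also have "\<dots> \<le> 2 * (\<kappa> * g * ?V) / g\<^sup>2 * g"
        using ev g by (intro mult_right_mono divide_right_mono) auto
      also have "\<dots> = 2 * \<kappa> * ?V"
        using g by (simp add: field_simps power2_eq_square)
      finally show ?thesis .
    qed
    finally have "vnorm n (mat_apply n (householder n u) v)
        \<le> ?V + (10 * \<kappa> * ?V + (7 / 3 * \<kappa> * ?V + 2 * \<kappa> * ?V))"
      by simp
    also have "\<dots> \<le> (1 + 24 * \<kappa>) * ?V"
      using mult_nonneg_nonneg[OF \<kappa>(1), of ?V] by (simp add: algebra_simps L2_set_nonneg)
    finally show "vnorm n (mat_apply n (householder n u) v) \<le> (1 + 24 * \<kappa>) * ?V" .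
  qed
qed

text \<open>The purifying states are \<open>\<psi>\<^sub>a = \<plusminus>|a\<rangle>\<close>, so the oracle vectors live on the basis indices \<open>a * m + a\<close>.\<close>

definition diag_vec :: "nat \<Rightarrow> (nat \<Rightarrow> 'a::zero) \<Rightarrow> nat \<Rightarrow> 'a" where
  "diag_vec m c r = (if r mod m = r div m then c (r div m) else 0)"

lemma diag_vec_index: "b < m \<Longrightarrow> diag_vec m c (a * m + b) = (if a = b then c a else 0)"
  by (auto simp: diag_vec_def)

lemma sum_diag:
  fixes f :: "nat \<Rightarrow> 'a::comm_monoid_add"
  assumes "d \<le> m"
  shows "(\<Sum>r<d * m. if r mod m = r div m then f (r div m) else 0) = (\<Sum>a<d. f a)"
proof -
  have "(\<Sum>r<d * m. if r mod m = r div m then f (r div m) else 0) =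
      (\<Sum>a<d. \<Sum>b<m. if a = b then f a else 0)"
    unfolding sum_lessThan_mult by (intro sum.cong refl) auto
  also have "\<dots> = (\<Sum>a<d. f a)"
    using assms by (intro sum.cong refl) auto
  finally show ?thesis .
qed

lemma sum_diag_vec_mult:
  fixes c e :: "nat \<Rightarrow> 'a::comm_semiring_0"
  assumes "d \<le> m"
  shows "(\<Sum>r<d * m. diag_vec m c r * diag_vec m e r) = (\<Sum>a<d. c a * e a)"
  unfolding sum_diag[OF assms, symmetric] by (intro sum.cong refl) (simp add: diag_vec_def)

lemma of_real_diag_vec: "of_real (diag_vec m c r) = diag_vec m (\<lambda>a. of_real (c a)) r"
  by (simp add: diag_vec_def)

text \<open>The squared entries of the first column of the reflection along \<open>c\<close>, that
  is, of the image of the initial basis vector.\<close>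

definition householder_dist :: "nat \<Rightarrow> (nat \<Rightarrow> real) \<Rightarrow> nat \<Rightarrow> real" where
  "householder_dist d c a = ((if a = 0 then 1 else 0) - 2 * c 0 * c a / (\<Sum>k<d. c k * c k))\<^sup>2"

lemma is_distribution_householder:
  assumes "0 < d" "(\<Sum>k<d. c k * c k) \<noteq> 0"
  shows "is_distribution d (householder_dist d c)"
proof -
  define G where "G = (\<Sum>k<d. c k * c k)"
  have "(\<Sum>a<d. householder_dist d c a) =
     (\<Sum>a<d. (if a = 0 then 1 - 4 * c 0 * c 0 / G else 0) + 4 * c 0 * c 0 / G\<^sup>2 * (c a * c a))"
    unfolding householder_dist_def G_def[symmetric]
    by (intro sum.cong refl) (auto simp: algebra_simps power2_eq_square)
  also have "\<dots> = 1 - 4 * c 0 * c 0 / G + 4 * c 0 * c 0 / G\<^sup>2 * G"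
    using assms by (simp add: sum.distrib sum_distrib_left G_def)
  also have "\<dots> = 1"
    using assms(2) by (simp add: G_def[symmetric] field_simps power2_eq_square)
  finally show ?thesis
    by (simp add: is_distribution_def householder_dist_def)
qed

lemma purified_oracle_householder:
  fixes c :: "nat \<Rightarrow> real"
  assumes d: "0 < d" "d \<le> m" and G: "(\<Sum>k<d. c k * c k) \<noteq> 0"
  shows "purified_oracle d m (householder_dist d c) (householder (d * m) (diag_vec m (\<lambda>a. of_real (c a))))"
proof -
  let ?u = "diag_vec m (\<lambda>a. complex_of_real (c a))"
  have u: "?u = (\<lambda>r. of_real (diag_vec m c r))"
    by (simp add: of_real_diag_vec)
  define x where "x a = (if a = 0 then 1 else 0) - 2 * c 0 * c a / (\<Sum>k<d. c k * c k)" for a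
  \<comment> \<open>A purified oracle prescribes nonnegative roots, so the sign of the amplitude
    \<open>x a\<close> is absorbed into the purifying state.\<close>
  define \<psi> where "\<psi> a b = (if a = b then if 0 \<le> x a then 1 else -1 else (0::complex))" for a b :: nat
  have uu: "vdot (d * m) ?u ?u = of_real (\<Sum>k<d. c k * c k)"
    by (simp add: sum_diag_vec_mult[OF d(2)])
  have "is_unitary (d * m) (householder (d * m) ?u)"
    unfolding u by (rule is_unitary_householder) (use G in \<open>simp add: sum_diag_vec_mult[OF d(2)]\<close>)
  moreover have "(\<Sum>b<m. cnj (\<psi> i b) * \<psi> j b) = (if i = j then 1 else 0)" if "i < d" "j < d" for i j
  proof -
    have "(\<Sum>b<m. cnj (\<psi> i b) * \<psi> j b) = (\<Sum>b<m. if b = i then (if i = j then 1 else 0) else 0)"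
      by (intro sum.cong refl) (auto simp: \<psi>_def)
    then show ?thesis using that d by simp
  qed
  moreover have "mat_apply (d * m) (householder (d * m) ?u) (basis_vec 0) (a * m + b)
      = complex_of_real (sqrt (householder_dist d c a)) * \<psi> a b" if "a < d" "b < m" for a b
  proof -
    have "a * m + b < Suc a * m" using that by simp
    also have "\<dots> \<le> d * m" using that by (intro mult_right_mono) auto
    finally have r: "a * m + b < d * m" .
    have "vdot (d * m) ?u (basis_vec 0) = (\<Sum>s<d * m. if s = 0 then ?u s else 0)"
      by (intro sum.cong refl) (auto simp: basis_vec_def)
    also have "\<dots> = of_real (c 0)"
      using d r diag_vec_index[of 0 m "\<lambda>a. complex_of_real (c a)" 0] by (auto simp: sum.delta)
    finally have "mat_apply (d * m) (householder (d * m) ?u) (basis_vec 0) (a * m + b)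
        = (if a = b then of_real (x a) else 0)"
      unfolding mat_apply_householder[OF r] uu diag_vec_index[OF that(2)] x_def
      using that by (auto simp: basis_vec_def)
    moreover have "sqrt (householder_dist d c a) = \<bar>x a\<bar>"
      by (simp add: householder_dist_def x_def)
    ultimately show ?thesis
      by (simp add: \<psi>_def)
  qed
  ultimately show ?thesis
    unfolding purified_oracle_def by blast
qed

lemma householder_dist_surj:
  assumes "is_distribution d q" "0 < d"
  obtains c where "(\<Sum>k<d. c k * c k) \<noteq> 0" "\<And>a. a < d \<Longrightarrow> householder_dist d c a = q a"
proof
  \<comment> \<open>The reflection along \<open>e - v\<close> maps the first basis vector
    \<open>e\<close> to the unit vector \<open>v\<close> of signed roots of \<open>q\<close>. The
    minus sign of \<open>v\<close> at index 0 keeps \<open>e - v\<close> nonzero even when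
    \<open>q\<close> is concentrated there.\<close>
  define c where "c a = (if a = 0 then 1 + sqrt (q 0) else - sqrt (q a))" for a
  have q: "0 \<le> q a" if "a < d" for a
    using assms that by (auto simp: is_distribution_def)
  have "(\<Sum>k<d. c k * c k) = (\<Sum>k<d. (if k = 0 then 1 + 2 * sqrt (q 0) else 0) + q k)"
    by (intro sum.cong refl) (use q in \<open>auto simp: c_def algebra_simps\<close>)
  also have "\<dots> = 2 * (1 + sqrt (q 0))"
    using assms by (simp add: sum.distrib is_distribution_def)
  finally have G: "(\<Sum>k<d. c k * c k) = 2 * (1 + sqrt (q 0))" .
  have pos: "0 < 1 + sqrt (q 0)"
    using q[OF assms(2)] by (simp add: add_pos_nonneg)
  then show "(\<Sum>k<d. c k * c k) \<noteq> 0"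
    unfolding G by simp
  show "householder_dist d c a = q a" if "a < d" for a
    unfolding householder_dist_def G using pos q[OF that] q[OF assms(2)] by (simp add: c_def)
qed

section \<open>Matching moments and product measures\<close>

text \<open>When the Taylor series of \<open>F\<close> is summed against \<open>\<nu>\<close>, the
  moments kill all orders below \<open>M\<close>. Cauchy's estimate at radius \<open>3 * R\<close>
  bounds coefficient \<open>n\<close> by \<open>B / (3 * R) ^ n\<close>. As the points of
  \<open>S\<close> have size at most \<open>R\<close>, the remaining terms are dominated by a
  geometric series of ratio 1/3, whose sum supplies the factor 3/2.\<close>

lemma vanishing_moments_holomorphic_bound:
  fixes F :: "complex \<Rightarrow> complex" and \<nu> :: "real \<Rightarrow> real"
  assumes hol: "F holomorphic_on ball 0 r" and R: "0 < R" "3 * R < r"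
    and B: "\<And>z. cmod z \<le> 3 * R \<Longrightarrow> cmod (F z) \<le> B"
    and S: "\<And>x. x \<in> S \<Longrightarrow> \<bar>x\<bar> \<le> R"
    and moments: "\<And>k. k < M \<Longrightarrow> (\<Sum>x\<in>S. \<nu> x * x ^ k) = 0"
  shows "cmod (\<Sum>x\<in>S. of_real (\<nu> x) * F (of_real x)) \<le> (\<Sum>x\<in>S. \<bar>\<nu> x\<bar>) * B * (3 / 2) / 3 ^ M"
proof -
  define a where "a n = (deriv ^^ n) F 0 / fact n" for n
  define f where "f n = a n * of_real (\<Sum>x\<in>S. \<nu> x * x ^ n)" for n
  define C where "C = (\<Sum>x\<in>S. \<bar>\<nu> x\<bar>) * B"
  have a: "cmod (a n) \<le> B / (3 * R) ^ n" for n
  proof -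
    have "cmod ((deriv ^^ n) F 0) \<le> fact n * B / (3 * R) ^ n"
    proof (rule Cauchy_inequality)
      show "F holomorphic_on ball 0 (3 * R)"
        using hol by (rule holomorphic_on_subset) (use R in auto)
      show "continuous_on (cball 0 (3 * R)) F"
        using hol by (intro holomorphic_on_imp_continuous_on) (erule holomorphic_on_subset, use R in auto)
    qed (use R B in auto)
    then show ?thesis
      by (simp add: a_def norm_divide field_simps)
  qed
  have f: "cmod (f n) \<le> C * (1 / 3) ^ n" for n
  proof -
    have "\<bar>\<Sum>x\<in>S. \<nu> x * x ^ n\<bar> \<le> (\<Sum>x\<in>S. \<bar>\<nu> x\<bar> * R ^ n)"
      by (rule order_trans[OF sum_abs])
         (auto intro!: sum_mono mult_left_mono power_mono S simp: abs_mult power_abs)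
    then have "cmod (f n) \<le> B / (3 * R) ^ n * ((\<Sum>x\<in>S. \<bar>\<nu> x\<bar>) * R ^ n)"
      unfolding f_def norm_mult norm_of_real sum_distrib_right[symmetric]
      using a[of n] order_trans[OF norm_ge_zero a[of n]] by (intro mult_mono) auto
    also have "\<dots> = C * (1 / 3) ^ n"
      using R by (simp add: C_def power_mult_distrib field_simps)
    finally show ?thesis .
  qed
  have "(\<lambda>n. \<Sum>x\<in>S. of_real (\<nu> x) * (a n * (of_real x - 0) ^ n)) sums (\<Sum>x\<in>S. of_real (\<nu> x) * F (of_real x))"
    unfolding a_def
  proof (intro sums_sum sums_mult holomorphic_power_series[OF hol])
    fix x assume "x \<in> S"
    then show "complex_of_real x \<in> ball 0 r"
      using S[of x] R by simp
  qed
  then have "f sums (\<Sum>x\<in>S. of_real (\<nu> x) * F (of_real x))"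
    by (simp add: f_def[abs_def] sum_distrib_left mult_ac)
  moreover have "(\<Sum>n<M. f n) = 0"
    by (intro sum.neutral) (simp add: f_def moments)
  ultimately have sums: "(\<lambda>n. f (n + M)) sums (\<Sum>x\<in>S. of_real (\<nu> x) * F (of_real x))"
    by (simp add: sums_iff_shift)
  have geo: "(\<lambda>n. C * (1 / 3) ^ M * (1 / 3 :: real) ^ n) sums (C * (1 / 3) ^ M * (1 / (1 - 1 / 3)))"
    by (intro sums_mult geometric_sums) simp
  have "cmod (suminf (\<lambda>n. f (n + M))) \<le> (\<Sum>n. C * (1 / 3) ^ M * (1 / 3) ^ n)"
  proof (rule norm_suminf_le)
    show "cmod (f (n + M)) \<le> C * (1 / 3) ^ M * (1 / 3) ^ n" for n
      using f[of "n + M"] by (simp add: power_add mult_ac)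
  qed (use geo in \<open>rule sums_summable\<close>)
  then show ?thesis
    using sums_unique[OF sums] sums_unique[OF geo] by (simp add: C_def power_divide)
qed

text \<open>The sum is the coefficient of degree \<open>card S - 1\<close> in the Lagrange
  interpolant of \<open>x ^ k\<close> on \<open>S\<close>. That interpolant is the monomial itself,
  which has smaller degree.\<close>

lemma sum_power_divided_difference:
  fixes S :: "'a::field set"
  assumes fin: "finite S" and k: "Suc k < card S"
  shows "(\<Sum>x\<in>S. x ^ k / (\<Prod>y\<in>S - {x}. x - y)) = 0"
proof -
  define l where "l x = (\<Prod>y\<in>S - {x}. [:- y, 1:])" for x
  define L where "L = (\<Sum>x\<in>S. smult (x ^ k / (\<Prod>y\<in>S - {x}. x - y)) (l x))"
  have deg: "degree (l x) = card S - 1" and lead: "coeff (l x) (card S - 1) = 1" if "x \<in> S" for x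
  proof -
    show d: "degree (l x) = card S - 1"
      unfolding l_def using that fin by (subst degree_prod_eq_sum_degree) auto
    have "lead_coeff (l x) = 1"
      unfolding l_def by (simp add: lead_coeff_prod)
    then show "coeff (l x) (card S - 1) = 1"
      by (simp add: d)
  qed
  have "L = monom 1 k"
  proof (rule poly_eqI_degree)
    fix z assume z: "z \<in> S"
    have nz: "(\<Prod>y\<in>S - {z}. z - y) \<noteq> 0"
      using fin by auto
    have "poly L z = (\<Sum>x\<in>S. if x = z then z ^ k else 0)"
      unfolding L_def poly_sum
    proof (intro sum.cong refl)
      fix x assume "x \<in> S"
      have "poly (l x) z = 0" if "x \<noteq> z"
        using that z fin by (auto simp: l_def poly_prod)
      moreover have "poly (l z) z = (\<Prod>y\<in>S - {z}. z - y)"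
        by (simp add: l_def poly_prod)
      ultimately show "poly (smult (x ^ k / (\<Prod>y\<in>S - {x}. x - y)) (l x)) z = (if x = z then z ^ k else 0)"
        using nz by auto
    qed
    then show "poly L z = poly (monom 1 k) z"
      using z fin by (simp add: poly_monom)
  next
    have "degree L \<le> card S - 1"
      unfolding L_def
      by (rule degree_sum_le[OF fin]) (metis deg degree_smult_le)
    then show "degree L < card S"
      using k by linarith
    show "degree (monom 1 k :: 'a poly) < card S"
      using k by (simp add: degree_monom_eq)
  qed
  then have "coeff L (card S - 1) = 0"
    using k by simp
  then show ?thesis
    unfolding L_def coeff_sum coeff_smult by (simp only: lead mult_1_right cong: sum.cong)
qed

text \<open>The expectation of \<open>F\<close> over \<open>D\<close> independent coordinates, as
  iterated finite sums, so that coordinates can be split off by induction. Coordinates from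
  \<open>D\<close> on hold the default 0.\<close>

primrec prod_expect :: "real set \<Rightarrow> (real \<Rightarrow> real) \<Rightarrow> nat \<Rightarrow> ((nat \<Rightarrow> real) \<Rightarrow> real) \<Rightarrow> real" where
  "prod_expect S \<mu> 0 F = F (\<lambda>_. 0)"
| "prod_expect S \<mu> (Suc D) F = (\<Sum>x\<in>S. \<mu> x * prod_expect S \<mu> D (\<lambda>z. F (z(D := x))))"

lemma prod_expect_add: "prod_expect S \<mu> D (\<lambda>z. F z + G z) = prod_expect S \<mu> D F + prod_expect S \<mu> D G"
  by (induction D arbitrary: F G) (simp_all add: algebra_simps sum.distrib)

lemma prod_expect_mult: "prod_expect S \<mu> D (\<lambda>z. c * F z) = c * prod_expect S \<mu> D F"
  by (induction D arbitrary: F) (simp_all add: sum_distrib_left mult_ac)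

lemma prod_expect_const:
  assumes "(\<Sum>x\<in>S. \<mu> x) = 1"
  shows "prod_expect S \<mu> D (\<lambda>z. c) = c"
  by (induction D) (simp_all add: sum_distrib_right[symmetric] assms)

lemma prod_expect_mono:
  assumes "\<And>x. x \<in> S \<Longrightarrow> 0 \<le> \<mu> x" "\<And>z. F z \<le> G z"
  shows "prod_expect S \<mu> D F \<le> prod_expect S \<mu> D G"
  using assms(2) by (induction D arbitrary: F G) (auto intro!: sum_mono mult_left_mono assms(1))

lemma prod_expect_sum_comm:
  "prod_expect S \<mu> D (\<lambda>z. \<Sum>x\<in>A. c x * F x z) = (\<Sum>x\<in>A. c x * prod_expect S \<mu> D (F x))"
proof (induction D arbitrary: F)
  case (Suc D)
  then show ?case
    by (simp add: sum_distrib_left) (subst sum.swap, simp add: mult_ac)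
qed simp

text \<open>Variances of independent centred variables add up: the cross term of the new coordinate
  with the others carries the vanishing factor \<open>\<Sum>x\<in>S. \<mu> x * g x\<close>.\<close>

lemma prod_expect_sum_square:
  assumes "(\<Sum>x\<in>S. \<mu> x) = 1" and g: "(\<Sum>x\<in>S. \<mu> x * g x) = 0"
  shows "prod_expect S \<mu> D (\<lambda>z. (\<Sum>i<D. g (z i))\<^sup>2) = D * (\<Sum>x\<in>S. \<mu> x * (g x)\<^sup>2)"
proof (induction D)
  case (Suc D)
  let ?A = "\<lambda>z. \<Sum>i<D. g (z i)"
  have "prod_expect S \<mu> D (\<lambda>z. (\<Sum>i<Suc D. g ((z(D := x)) i))\<^sup>2) =
      prod_expect S \<mu> D (\<lambda>z. (?A z)\<^sup>2) + (2 * g x * prod_expect S \<mu> D ?A + (g x)\<^sup>2)" for x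
  proof -
    have "(\<Sum>i<Suc D. g ((z(D := x)) i))\<^sup>2 = (?A z)\<^sup>2 + (2 * g x * ?A z + (g x)\<^sup>2)" for z :: "nat \<Rightarrow> real"
      by (simp add: power2_eq_square algebra_simps)
    then show ?thesis
      by (simp only: prod_expect_add prod_expect_mult prod_expect_const[OF assms(1)])
  qed
  then have "prod_expect S \<mu> (Suc D) (\<lambda>z. (\<Sum>i<Suc D. g (z i))\<^sup>2) =
      (\<Sum>x\<in>S. \<mu> x) * prod_expect S \<mu> D (\<lambda>z. (?A z)\<^sup>2)
      + 2 * prod_expect S \<mu> D ?A * (\<Sum>x\<in>S. \<mu> x * g x) + (\<Sum>x\<in>S. \<mu> x * (g x)\<^sup>2)"
    by (simp add: sum_distrib_left sum_distrib_right sum.distrib algebra_simps)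
  then show ?case
    using Suc.IH by (simp add: assms algebra_simps)
qed simp

text \<open>The coordinates change law one at a time while the others are averaged over a
  probability measure, so each exchange costs at most \<open>\<eta>\<close>.\<close>

lemma prod_expect_hybrid:
  assumes \<mu>: "\<And>x. x \<in> S \<Longrightarrow> 0 \<le> \<mu> x" "(\<Sum>x\<in>S. \<mu> x) = 1"
    and \<mu>': "\<And>x. x \<in> S \<Longrightarrow> 0 \<le> \<mu>' x" "(\<Sum>x\<in>S. \<mu>' x) = 1"
    and F: "\<And>i z. i < D \<Longrightarrow> \<bar>\<Sum>x\<in>S. (\<mu> x - \<mu>' x) * F (z(i := x))\<bar> \<le> \<eta>"
  shows "\<bar>prod_expect S \<mu> D F - prod_expect S \<mu>' D F\<bar> \<le> D * \<eta>"
  using F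
proof (induction D arbitrary: F)
  case (Suc D)
  let ?F = "\<lambda>x z. F (z(D := x))"
  have IH: "\<bar>prod_expect S \<mu> D (?F x) - prod_expect S \<mu>' D (?F x)\<bar> \<le> D * \<eta>" for x
  proof (rule Suc.IH)
    fix i z assume "i < D"
    then show "\<bar>\<Sum>y\<in>S. (\<mu> y - \<mu>' y) * F ((z(i := y))(D := x))\<bar> \<le> \<eta>"
      using Suc.prems[of i "z(D := x)"] by (simp only: fun_upd_twist[of i D] less_SucI)
  qed
  have "prod_expect S \<mu> (Suc D) F - prod_expect S \<mu>' (Suc D) F =
      (\<Sum>x\<in>S. \<mu> x * (prod_expect S \<mu> D (?F x) - prod_expect S \<mu>' D (?F x)))
      + (\<Sum>x\<in>S. (\<mu> x - \<mu>' x) * prod_expect S \<mu>' D (?F x))"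
    by (simp add: algebra_simps sum.distrib sum_subtractf)
  also have "(\<Sum>x\<in>S. (\<mu> x - \<mu>' x) * prod_expect S \<mu>' D (?F x)) =
      prod_expect S \<mu>' D (\<lambda>z. \<Sum>x\<in>S. (\<mu> x - \<mu>' x) * F (z(D := x)))" (is "_ = ?H")
    by (simp add: prod_expect_sum_comm)
  finally have eq: "prod_expect S \<mu> (Suc D) F - prod_expect S \<mu>' (Suc D) F =
      (\<Sum>x\<in>S. \<mu> x * (prod_expect S \<mu> D (?F x) - prod_expect S \<mu>' D (?F x))) + ?H" .
  have 1: "\<bar>\<Sum>x\<in>S. \<mu> x * (prod_expect S \<mu> D (?F x) - prod_expect S \<mu>' D (?F x))\<bar> \<le> (\<Sum>x\<in>S. \<mu> x * (D * \<eta>))"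
    by (rule order_trans[OF sum_abs], rule sum_mono)
       (use IH \<mu> in \<open>auto simp: abs_mult intro!: mult_left_mono\<close>)
  have F: "(\<Sum>x\<in>S. (\<mu> x - \<mu>' x) * F (z(D := x))) \<le> \<eta>"
      "- \<eta> \<le> (\<Sum>x\<in>S. (\<mu> x - \<mu>' x) * F (z(D := x)))" for z
    using Suc.prems[OF lessI, of z] by linarith+
  have "?H \<le> prod_expect S \<mu>' D (\<lambda>_. \<eta>)" "prod_expect S \<mu>' D (\<lambda>_. - \<eta>) \<le> ?H"
    by (intro prod_expect_mono \<mu>' F; assumption)+
  then have 2: "?H \<le> \<eta>" and 3: "- \<eta> \<le> ?H"
    by (simp_all only: prod_expect_const[OF \<mu>'(2)])
  have const: "(\<Sum>x\<in>S. \<mu> x * (D * \<eta>)) = D * \<eta>"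
    by (simp only: sum_distrib_right[symmetric] \<mu>(2) mult_1_left)
  have step: "real (Suc D) * \<eta> = D * \<eta> + \<eta>"
    by (simp add: algebra_simps)
  show ?case
    unfolding eq step using 1 2 3 unfolding const by linarith
qed simp

section \<open>Two measures with matching moments\<close>

text \<open>In other terms, the binomial coefficient \<open>2 * K choose (K + i)\<close> is at most
  the central one. This bounds the products of distances between far nodes from below.\<close>

lemma fact_le_prod_shift:
  assumes "i \<le> (K::nat)"
  shows "fact K * fact K \<le> (fact (K - i) * fact (K + i) :: real)"
  using assms
proof (induction i)
  case (Suc i)
  then have eq: "fact (K - i) = (real K - real i) * fact (K - Suc i)"
    by (subst fact_reduce) (auto simp: of_nat_diff)
  have "fact K * fact K \<le> (fact (K - i) * fact (K + i) :: real)"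
    using Suc by simp
  also have "\<dots> = (real K - real i) * (fact (K - Suc i) * fact (K + i))"
    by (simp only: eq mult.assoc)
  also have "\<dots> \<le> real (Suc (K + i)) * (fact (K - Suc i) * fact (K + i))"
    by (intro mult_right_mono) auto
  also have "\<dots> = fact (K - Suc i) * fact (K + Suc i)"
    by (simp only: add_Suc_right fact_Suc mult.left_commute mult.assoc)
  finally show ?case .
qed simp

lemma prod_abs_diff:
  assumes "0 < i" "i \<le> K"
  shows "(\<Prod>j\<in>{1..K} - {i}. \<bar>real i - real j\<bar>) = fact (i - 1) * fact (K - i)"
  using assms(2)
proof (induction K rule: dec_induct)
  case base
  have "(\<Prod>j\<in>{1..i} - {i}. \<bar>real i - real j\<bar>) = (\<Prod>j\<in>{1..<i}. real (i - j))"
    by (intro prod.cong) (auto simp: of_nat_diff)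
  also have "\<dots> = real (\<Prod>j\<in>{1..<i}. j)"
    unfolding of_nat_prod
    by (rule prod.reindex_bij_witness[of _ "\<lambda>j. i - j" "\<lambda>j. i - j"]) auto
  also have "\<dots> = fact (i - 1)"
    using assms(1) by (simp add: fact_prod atLeastLessThanSuc_atLeastAtMost[symmetric] del: of_nat_prod)
  finally show ?case by simp
next
  case (step K)
  have "{1..Suc K} - {i} = insert (Suc K) ({1..K} - {i})"
    using step by auto
  then show ?case
    using step by (simp add: Suc_diff_le)
qed

lemma prod_add_fact: "(\<Prod>j=1..K. real i + real j) * fact i = fact (K + i)"
  by (induction K) (simp_all add: mult_ac add_ac)

lemma sum_inverse_squares: "(\<Sum>j=1..K. 1 / (real j)\<^sup>2) \<le> 2"
proof -
  have *: "(\<Sum>j=1..Suc K. 1 / (real j)\<^sup>2) \<le> 2 - 1 / real (Suc K)" for K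
  proof (induction K)
    case (Suc K)
    have "1 / (real (Suc (Suc K)))\<^sup>2 \<le> 1 / (real (Suc K) * real (Suc (Suc K)))"
      by (intro divide_left_mono) (auto simp: power2_eq_square)
    also have "\<dots> = 1 / real (Suc K) - 1 / real (Suc (Suc K))"
      by (simp add: field_simps)
    finally show ?case
      using Suc by simp
  qed simp
  show ?thesis
  proof (cases K)
    case (Suc K')
    have "0 \<le> 1 / real (Suc K')"
      by simp
    then show ?thesis
      using *[of K'] unfolding Suc by linarith
  qed simp
qed

text \<open>The Weierstrass product inequality; it limits how much the far nodes can shrink a
  product evaluated near 0.\<close>

lemma one_minus_sum_le_prod:
  fixes f :: "'a \<Rightarrow> real"
  assumes "finite A" "\<And>x. x \<in> A \<Longrightarrow> 0 \<le> f x \<and> f x \<le> 1"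
  shows "1 - sum f A \<le> (\<Prod>x\<in>A. 1 - f x)"
  using assms
proof (induction A rule: finite_induct)
  case (insert a A)
  have p: "(\<Prod>x\<in>A. 1 - f x) \<le> 1" "0 \<le> (\<Prod>x\<in>A. 1 - f x)"
    using insert.prems by (auto intro!: prod_le_1 prod_nonneg)
  have "f a * (\<Prod>x\<in>A. 1 - f x) \<le> f a * 1"
    using p insert.prems by (intro mult_left_mono) auto
  then show ?case
    using insert by (simp add: algebra_simps)
qed simp

text \<open>The spacing 8 is wide against the near nodes, of size at most 2, so that the far nodes
  lower the products there by at most a factor 7/8.\<close>

definition far_nodes :: "nat \<Rightarrow> real set" where
  "far_nodes K = (\<lambda>j. 8 * real j) ` {1..K} \<union> (\<lambda>j. - (8 * real j)) ` {1..K}"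

text \<open>The nodes near \<open>0\<close> beyond the multiples of \<open>8\<close> make the divided-difference weights decay like
  \<open>1/j^4\<close>; with equally spaced nodes alone they would be almost flat.\<close>

definition nodes :: "nat \<Rightarrow> real set" where
  "nodes K = {0, 1, -1, 2, -2} \<union> far_nodes K"

lemma finite_nodes: "finite (far_nodes K)" "finite (nodes K)"
  by (auto simp: far_nodes_def nodes_def)

lemma far_nodes_ge: "x \<in> far_nodes K \<Longrightarrow> 8 \<le> \<bar>x\<bar>"
  by (auto simp: far_nodes_def)

lemma far_nodes_disjoint: "{0, 1, -1, 2, -2} \<inter> far_nodes K = {}"
  using far_nodes_ge[of _ K] by fastforce

lemma prod_far_nodes:
  fixes g :: "real \<Rightarrow> real"
  shows "prod g (far_nodes K) = (\<Prod>j=1..K. g (8 * real j)) * (\<Prod>j=1..K. g (- (8 * real j)))"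
  unfolding far_nodes_def
  by (subst prod.union_disjoint) (force simp: prod.reindex inj_on_def)+

lemma sum_far_nodes:
  fixes g :: "real \<Rightarrow> real"
  shows "sum g (far_nodes K) = (\<Sum>j=1..K. g (8 * real j)) + (\<Sum>j=1..K. g (- (8 * real j)))"
  unfolding far_nodes_def
  by (subst sum.union_disjoint) (force simp: sum.reindex inj_on_def)+

lemma card_nodes: "card (nodes K) = 2 * K + 5"
proof -
  have "card (far_nodes K) = 2 * K"
    unfolding far_nodes_def
    by (subst card_Un_disjoint) (force simp: card_image inj_on_def)+
  then show ?thesis
    unfolding nodes_def using far_nodes_disjoint[of K]
    by (subst card_Un_disjoint) (auto simp: finite_nodes)
qed

lemma sum_nodes:
  fixes g :: "real \<Rightarrow> real"
  shows "sum g (nodes K) = g 0 + g 1 + g (-1) + g 2 + g (-2) + (\<Sum>j=1..K. g (8 * real j) + g (- (8 * real j)))"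
  unfolding nodes_def using far_nodes_disjoint[of K]
  by (subst sum.union_disjoint) (auto simp: finite_nodes sum_far_nodes sum.distrib)

text \<open>For a node \<open>x\<close>, the derivative at \<open>x\<close> of the monic polynomial
  with root set \<open>nodes K\<close>; its reciprocal is the divided-difference weight of
  \<open>x\<close>.\<close>

definition node_prod :: "nat \<Rightarrow> real \<Rightarrow> real" where
  "node_prod K x = (\<Prod>y\<in>nodes K - {x}. x - y)"

text \<open>The modulus of the product of all far nodes, the common scale for all values of
  \<open>node_prod\<close>.\<close>

definition far_prod :: "nat \<Rightarrow> real" where
  "far_prod K = (\<Prod>j=1..K. 64 * (real j)\<^sup>2)"

lemma far_prod_pos: "0 < far_prod K"
  by (auto simp: far_prod_def intro!: prod_pos)

lemma far_prod_fact: "far_prod K = 8 ^ K * 8 ^ K * fact K * fact K"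
  by (induction K) (simp_all add: far_prod_def power2_eq_square algebra_simps)

lemma node_prod_minus: "\<bar>node_prod K (- x)\<bar> = \<bar>node_prod K x\<bar>"
proof -
  have "(\<Prod>y\<in>nodes K - {- x}. \<bar>- x - y\<bar>) = (\<Prod>y\<in>nodes K - {x}. \<bar>x - y\<bar>)"
    by (rule prod.reindex_bij_witness[of _ uminus uminus])
       (auto simp: nodes_def far_nodes_def)
  then show ?thesis
    by (simp add: node_prod_def abs_prod)
qed

text \<open>The far nodes pair off as \<open>8 * j\<close> and \<open>- 8 * j\<close>, and relative
  to \<open>x = 0\<close> each pair contributes a factor
  \<open>1 - x\<^sup>2 / (64 * j\<^sup>2)\<close>. For \<open>\<bar>x\<bar> \<le> 2\<close> the
  subtracted terms sum to at most 4/64 * 2 = 1/8.\<close>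

lemma abs_far_prod_near:
  assumes "\<bar>x\<bar> \<le> 2"
  shows "\<bar>\<Prod>y\<in>far_nodes K. x - y\<bar> \<le> far_prod K" "7 / 8 * far_prod K \<le> \<bar>\<Prod>y\<in>far_nodes K. x - y\<bar>"
proof -
  let ?f = "\<lambda>j. (x\<^sup>2 / 64) / (real j)\<^sup>2"
  have x2: "x\<^sup>2 \<le> 4"
    using abs_le_square_iff[of x 2] assms by simp
  have f: "0 \<le> ?f j \<and> ?f j \<le> 1" if "j \<in> {1..K}" for j
  proof -
    have "1 \<le> (real j)\<^sup>2" using that by simp
    then show ?thesis using x2 by (simp add: divide_le_eq)
  qed
  have "(\<Prod>y\<in>far_nodes K. x - y) = (\<Prod>j=1..K. - (64 * (real j)\<^sup>2) * (1 - ?f j))"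
    unfolding prod_far_nodes prod.distrib[symmetric]
    by (intro prod.cong) (auto simp: field_simps power2_eq_square)
  then have eq: "\<bar>\<Prod>y\<in>far_nodes K. x - y\<bar> = far_prod K * (\<Prod>j=1..K. 1 - ?f j)"
    unfolding far_prod_def prod.distrib[symmetric]
    by (simp only: abs_prod) (use f in \<open>intro prod.cong, auto simp: abs_mult\<close>)
  have "(\<Prod>j=1..K. 1 - ?f j) \<le> 1"
    using f by (intro prod_le_1) auto
  then show "\<bar>\<Prod>y\<in>far_nodes K. x - y\<bar> \<le> far_prod K"
    unfolding eq using far_prod_pos[of K] by simp
  have "(\<Sum>j=1..K. ?f j) = x\<^sup>2 / 64 * (\<Sum>j=1..K. 1 / (real j)\<^sup>2)"
    by (simp add: sum_distrib_left)
  also have "\<dots> \<le> 4 / 64 * 2"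
    using x2 sum_inverse_squares by (intro mult_mono sum_nonneg) auto
  finally have "7 / 8 \<le> (\<Prod>j=1..K. 1 - ?f j)"
    using one_minus_sum_le_prod[of "{1..K}" ?f] f by auto
  then show "7 / 8 * far_prod K \<le> \<bar>\<Prod>y\<in>far_nodes K. x - y\<bar>"
    unfolding eq using far_prod_pos[of K] by simp
qed

lemma node_prod_near:
  assumes "x \<in> {0, 1, -1, 2, -2}"
  shows "node_prod K x = (\<Prod>y\<in>{0, 1, -1, 2, -2} - {x}. x - y) * (\<Prod>y\<in>far_nodes K. x - y)"
proof -
  have "nodes K - {x} = ({0, 1, -1, 2, -2} - {x}) \<union> far_nodes K"
    using far_nodes_disjoint[of K] assms unfolding nodes_def by blast
  then show ?thesis
    unfolding node_prod_def using far_nodes_disjoint[of K]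
    by (subst prod.union_disjoint[symmetric]) (auto simp: finite_nodes)
qed

lemma node_prod_0: "\<bar>node_prod K 0\<bar> = 4 * far_prod K"
proof -
  have "{0, 1, -1, 2, -2} - {0} = {1, -1, 2, -2::real}" by auto
  moreover have "\<bar>\<Prod>y\<in>far_nodes K. 0 - y\<bar> = far_prod K"
    by (simp add: prod_far_nodes abs_mult abs_prod far_prod_def prod.distrib[symmetric] power2_eq_square)
  ultimately show ?thesis
    using node_prod_near[of 0 K] by (simp add: abs_mult)
qed

text \<open>The other near nodes contribute 1 * 2 * 1 * 3 = 6, and 21/4 is 7/8 of that. At the node
  2 the same count gives 24 and 21.\<close>

lemma node_prod_1: "21 / 4 * far_prod K \<le> \<bar>node_prod K 1\<bar>" "\<bar>node_prod K 1\<bar> \<le> 6 * far_prod K"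
proof -
  have "{0, 1, -1, 2, -2} - {1} = {0, -1, 2, -2::real}" by auto
  then have "\<bar>node_prod K 1\<bar> = 6 * \<bar>\<Prod>y\<in>far_nodes K. 1 - y\<bar>"
    using node_prod_near[of 1 K] by (simp add: abs_mult)
  then show "21 / 4 * far_prod K \<le> \<bar>node_prod K 1\<bar>" "\<bar>node_prod K 1\<bar> \<le> 6 * far_prod K"
    using abs_far_prod_near[of 1 K] by auto
qed

lemma node_prod_2: "21 * far_prod K \<le> \<bar>node_prod K 2\<bar>"
proof -
  have "{0, 1, -1, 2, -2} - {2} = {0, 1, -1, -2::real}" by auto
  then have "\<bar>node_prod K 2\<bar> = 24 * \<bar>\<Prod>y\<in>far_nodes K. 2 - y\<bar>"
    using node_prod_near[of 2 K] by (simp add: abs_mult)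
  then show ?thesis
    using abs_far_prod_near[of 2 K] by auto
qed

text \<open>The near nodes contribute the quintic
  \<open>x * (x\<^sup>2 - 1) * (x\<^sup>2 - 4)\<close> at \<open>x = 8 * i\<close>. Its factor
  \<open>x\<close> completes the far distances to
  \<open>8 ^ (2 * K) * fact (K - i) * fact (K + i)\<close>, at least \<open>far_prod K\<close>; the
  other two factors are at least \<open>63 * i\<^sup>2\<close> and \<open>60 * i\<^sup>2\<close>,
  with product \<open>3780 * i ^ 4\<close>.\<close>

lemma node_prod_far:
  assumes i: "i \<in> {1..K}"
  shows "3780 * real i ^ 4 * far_prod K \<le> \<bar>node_prod K (8 * real i)\<bar>"
proof -
  let ?x = "8 * real i"
  have x: "?x \<in> far_nodes K" using i by (auto simp: far_nodes_def)
  have "nodes K - {?x} = {0, 1, -1, 2, -2} \<union> (far_nodes K - {?x})"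
    using far_nodes_disjoint[of K] x unfolding nodes_def by blast
  then have "node_prod K ?x = (\<Prod>y\<in>{0, 1, -1, 2, -2}. ?x - y) * (\<Prod>y\<in>far_nodes K - {?x}. ?x - y)"
    unfolding node_prod_def using far_nodes_disjoint[of K]
    by (subst prod.union_disjoint[symmetric]) (auto simp: finite_nodes)
  also have "(\<Prod>y\<in>{0, 1, -1, 2, -2}. ?x - y) = 8 * real i * ((64 * (real i)\<^sup>2 - 1) * (64 * (real i)\<^sup>2 - 4))"
    by (simp add: power2_eq_square algebra_simps)
  finally have 1: "\<bar>node_prod K ?x\<bar> = \<bar>8 * real i * ((64 * (real i)\<^sup>2 - 1) * (64 * (real i)\<^sup>2 - 4))\<bar>
      * (\<Prod>y\<in>far_nodes K - {?x}. \<bar>?x - y\<bar>)"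
    by (simp only: abs_mult abs_prod)
  have split: "far_nodes K - {?x} = (\<lambda>j. 8 * real j) ` ({1..K} - {i}) \<union> (\<lambda>j. - (8 * real j)) ` {1..K}"
    using i by (auto simp: far_nodes_def)
  have "(\<Prod>y\<in>far_nodes K - {?x}. \<bar>?x - y\<bar>) =
      (\<Prod>j\<in>{1..K} - {i}. \<bar>8 * real i - 8 * real j\<bar>) * (\<Prod>j=1..K. \<bar>8 * real i + 8 * real j\<bar>)"
    unfolding split by (subst prod.union_disjoint) (force simp: prod.reindex inj_on_def)+
  also have "\<dots> = (\<Prod>j\<in>{1..K} - {i}. 8 * \<bar>real i - real j\<bar>) * (\<Prod>j=1..K. 8 * (real i + real j))"
    by (intro arg_cong2[of _ _ _ _ "(*)"] prod.cong) (auto simp: abs_if)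
  also have "\<dots> = 8 ^ (K - 1) * (fact (i - 1) * fact (K - i)) * (8 ^ K * (\<Prod>j=1..K. real i + real j))"
    using i unfolding prod.distrib by (subst prod_abs_diff) auto
  finally have 2: "(\<Prod>y\<in>far_nodes K - {?x}. \<bar>?x - y\<bar>) =
      8 ^ (K - 1) * (fact (i - 1) * fact (K - i)) * (8 ^ K * (\<Prod>j=1..K. real i + real j))" .
  have "fact i = real i * fact (i - 1)" "(8::real) ^ K = 8 * 8 ^ (K - 1)"
    using i by (simp_all add: fact_reduce power_eq_if)
  then have "8 * real i * (\<Prod>y\<in>far_nodes K - {?x}. \<bar>?x - y\<bar>) =
      8 ^ K * 8 ^ K * (fact (K - i) * ((\<Prod>j=1..K. real i + real j) * fact i))"
    unfolding 2 by (simp add: mult_ac)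
  also have "\<dots> = 8 ^ K * 8 ^ K * (fact (K - i) * fact (K + i))"
    by (simp only: prod_add_fact)
  also have "\<dots> \<ge> far_prod K"
    using fact_le_prod_shift[of i K] i by (simp add: far_prod_fact mult.assoc)
  finally have 3: "far_prod K \<le> 8 * real i * (\<Prod>y\<in>far_nodes K - {?x}. \<bar>?x - y\<bar>)" .
  have i1: "1 \<le> (real i)\<^sup>2" using i by simp
  have "3780 * real i ^ 4 = (63 * (real i)\<^sup>2) * (60 * (real i)\<^sup>2)"
    by (simp add: power2_eq_square power4_eq_xxxx)
  also have "\<dots> \<le> (64 * (real i)\<^sup>2 - 1) * (64 * (real i)\<^sup>2 - 4)"
    using i1 by (intro mult_mono) auto
  finally have 4: "3780 * real i ^ 4 \<le> (64 * (real i)\<^sup>2 - 1) * (64 * (real i)\<^sup>2 - 4)" .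
  have "3780 * real i ^ 4 * far_prod K \<le> ((64 * (real i)\<^sup>2 - 1) * (64 * (real i)\<^sup>2 - 4)) *
      (8 * real i * (\<Prod>y\<in>far_nodes K - {?x}. \<bar>?x - y\<bar>))"
  proof (rule mult_mono[OF 4 3])
    show "0 \<le> (64 * (real i)\<^sup>2 - 1) * (64 * (real i)\<^sup>2 - 4)"
      by (rule order_trans[OF _ 4]) simp
  qed (use far_prod_pos[of K] in simp)
  also have "\<dots> = \<bar>node_prod K ?x\<bar>"
    unfolding 1 using i1 by (simp add: abs_mult)
  finally show ?thesis .
qed

text \<open>Divided-difference weights, rescaled so that near 0 they are of order 1 whatever
  \<open>K\<close> is.\<close>

definition node_weight :: "nat \<Rightarrow> real \<Rightarrow> real" where
  "node_weight K x = far_prod K / node_prod K x"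

lemma sum_node_weight_power:
  assumes "k < 2 * K + 4"
  shows "(\<Sum>x\<in>nodes K. node_weight K x * x ^ k) = 0"
proof -
  have "(\<Sum>x\<in>nodes K. x ^ k / node_prod K x) = 0"
    unfolding node_prod_def
    by (rule sum_power_divided_difference) (use assms in \<open>simp_all add: finite_nodes card_nodes\<close>)
  then have "far_prod K * (\<Sum>x\<in>nodes K. x ^ k / node_prod K x) = 0"
    by simp
  then show ?thesis
    by (simp add: node_weight_def sum_distrib_left)
qed

lemma abs_node_weight_minus: "\<bar>node_weight K (- x)\<bar> = \<bar>node_weight K x\<bar>"
  by (simp add: node_weight_def abs_divide node_prod_minus)

lemma abs_node_weight_0: "\<bar>node_weight K 0\<bar> = 1 / 4"
  using far_prod_pos[of K] by (simp add: node_weight_def abs_divide node_prod_0)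

lemma abs_node_weight_le:
  assumes "c * far_prod K \<le> \<bar>node_prod K x\<bar>" "0 < c"
  shows "\<bar>node_weight K x\<bar> \<le> 1 / c"
proof -
  have "0 < c * far_prod K"
    using assms far_prod_pos[of K] by simp
  moreover from this have "0 < \<bar>node_prod K x\<bar>"
    using assms(1) by linarith
  ultimately have "far_prod K / \<bar>node_prod K x\<bar> \<le> far_prod K / (c * far_prod K)"
    using assms far_prod_pos[of K] by (intro divide_left_mono mult_pos_pos) auto
  then show ?thesis
    using far_prod_pos[of K] by (simp add: node_weight_def abs_divide)
qed

lemma abs_node_weight_1: "\<bar>node_weight K 1\<bar> \<le> 4 / 21" "1 / 6 \<le> \<bar>node_weight K 1\<bar>"
proof -
  show "\<bar>node_weight K 1\<bar> \<le> 4 / 21"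
    using abs_node_weight_le[OF node_prod_1(1)] by simp
  have "0 < \<bar>node_prod K 1\<bar>"
    using node_prod_1(1)[of K] far_prod_pos[of K] by linarith
  then show "1 / 6 \<le> \<bar>node_weight K 1\<bar>"
    using node_prod_1(2)[of K] far_prod_pos[of K] by (simp add: node_weight_def abs_divide field_simps)
qed

lemma abs_node_weight_2: "\<bar>node_weight K 2\<bar> \<le> 1 / 21"
  using abs_node_weight_le[OF node_prod_2] by simp

lemma abs_node_weight_far:
  assumes "i \<in> {1..K}"
  shows "\<bar>node_weight K (8 * real i)\<bar> \<le> 1 / (3780 * real i ^ 4)"
  by (rule abs_node_weight_le[OF node_prod_far[OF assms]]) (use assms in auto)

text \<open>Far weights decay like \<open>1 / i ^ 4\<close>, so quadratic growth of \<open>g\<close>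
  still leaves a convergent sum. This controls both the second moment and the functional of
  \<open>node_weight_gap\<close> at the far nodes.\<close>

lemma sum_far_weights:
  assumes "\<And>i. i \<in> {1..K} \<Longrightarrow> g i \<le> c * (real i)\<^sup>2" "0 \<le> c"
  shows "(\<Sum>i=1..K. \<bar>node_weight K (8 * real i)\<bar> * g i) \<le> c / 1890"
proof -
  have "(\<Sum>i=1..K. \<bar>node_weight K (8 * real i)\<bar> * g i) \<le> (\<Sum>i=1..K. c / 3780 * (1 / (real i)\<^sup>2))"
  proof (rule sum_mono)
    fix i assume i: "i \<in> {1..K}"
    have "\<bar>node_weight K (8 * real i)\<bar> * g i \<le> \<bar>node_weight K (8 * real i)\<bar> * (c * (real i)\<^sup>2)"
      using assms(1)[OF i] by (intro mult_left_mono) auto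
    also have "\<dots> \<le> 1 / (3780 * real i ^ 4) * (c * (real i)\<^sup>2)"
      using abs_node_weight_far[OF i] assms(2) by (intro mult_right_mono) auto
    also have "\<dots> = c / 3780 * (1 / (real i)\<^sup>2)"
      using i by (simp add: field_simps power2_eq_square power4_eq_xxxx)
    finally show "\<bar>node_weight K (8 * real i)\<bar> * g i \<le> c / 3780 * (1 / (real i)\<^sup>2)" .
  qed
  also have "\<dots> = c / 3780 * (\<Sum>i=1..K. 1 / (real i)\<^sup>2)"
    by (simp only: sum_distrib_left)
  also have "\<dots> \<le> c / 3780 * 2"
    using sum_inverse_squares assms(2) by (intro mult_left_mono) auto
  finally show ?thesis by simp
qed

lemma sum_abs_node_weight:
  "(\<Sum>x\<in>nodes K. \<bar>node_weight K x\<bar>) \<le> 1" "1 / 4 \<le> (\<Sum>x\<in>nodes K. \<bar>node_weight K x\<bar>)"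
proof -
  have far: "(\<Sum>i=1..K. \<bar>node_weight K (8 * real i)\<bar> * 1) \<le> 1 / 1890"
    by (rule sum_far_weights) auto
  show "(\<Sum>x\<in>nodes K. \<bar>node_weight K x\<bar>) \<le> 1"
    unfolding sum_nodes abs_node_weight_minus abs_node_weight_0 sum.distrib
    using far abs_node_weight_1(1)[of K] abs_node_weight_2[of K] by simp
  have "\<bar>node_weight K 0\<bar> \<le> (\<Sum>x\<in>nodes K. \<bar>node_weight K x\<bar>)"
    by (rule member_le_sum) (auto simp: finite_nodes nodes_def)
  then show "1 / 4 \<le> (\<Sum>x\<in>nodes K. \<bar>node_weight K x\<bar>)"
    by (simp add: abs_node_weight_0)
qed

lemma sum_abs_node_weight_square: "(\<Sum>x\<in>nodes K. \<bar>node_weight K x\<bar> * x\<^sup>2) \<le> 1"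
proof -
  have far: "(\<Sum>i=1..K. \<bar>node_weight K (8 * real i)\<bar> * (8 * real i)\<^sup>2) \<le> 64 / 1890"
    by (rule sum_far_weights) (auto simp: power2_eq_square)
  have "(\<Sum>x\<in>nodes K. \<bar>node_weight K x\<bar> * x\<^sup>2) = 2 * \<bar>node_weight K 1\<bar> + 8 * \<bar>node_weight K 2\<bar>
      + 2 * (\<Sum>i=1..K. \<bar>node_weight K (8 * real i)\<bar> * (8 * real i)\<^sup>2)"
    unfolding sum_nodes abs_node_weight_minus sum.distrib power2_minus by simp
  then show ?thesis
    using far abs_node_weight_1(1)[of K] abs_node_weight_2[of K] by linarith
qed

text \<open>The quadratic part of \<open>\<bar>2 N x + x\<^sup>2\<bar>\<close> is annihilated by the weights; its negative part lives on
  \<open>(-2 N, 0)\<close>, where the node \<open>-1\<close> dominates.\<close>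

lemma node_weight_gap:
  fixes N :: real
  assumes N: "1 \<le> N"
  shows "N / 4 \<le> \<bar>\<Sum>x\<in>nodes K. node_weight K x * \<bar>2 * N * x + x\<^sup>2\<bar>\<bar>"
proof -
  define g where "g x = max 0 (- (2 * N * x + x\<^sup>2))" for x
  let ?w = "node_weight K"
  have "(\<Sum>x\<in>nodes K. ?w x * \<bar>2 * N * x + x\<^sup>2\<bar>) =
      (\<Sum>x\<in>nodes K. 2 * N * (?w x * x ^ 1) + ?w x * x ^ 2 + 2 * (?w x * g x))"
    by (intro sum.cong refl) (auto simp: g_def max_def algebra_simps abs_if)
  also have "\<dots> = 2 * (\<Sum>x\<in>nodes K. ?w x * g x)"
    unfolding sum.distrib sum_distrib_left[symmetric]
    using sum_node_weight_power[of 1 K] sum_node_weight_power[of 2 K] by simp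
  finally have eq: "(\<Sum>x\<in>nodes K. ?w x * \<bar>2 * N * x + x\<^sup>2\<bar>) = 2 * (\<Sum>x\<in>nodes K. ?w x * g x)" .
  have pos: "g x = 0" if "0 \<le> x" for x
  proof -
    have "0 \<le> 2 * N * x + x\<^sup>2"
      using that N by (intro add_nonneg_nonneg) auto
    then show ?thesis by (simp add: g_def)
  qed
  let ?far = "\<Sum>i=1..K. ?w (- (8 * real i)) * g (- (8 * real i))"
  have split: "(\<Sum>x\<in>nodes K. ?w x * g x) = ?w (-1) * (2 * N - 1) + (?w (-2) * (4 * N - 4) + ?far)"
    unfolding sum_nodes using N by (simp add: pos) (simp add: g_def max_def)
  have "\<bar>?far\<bar> \<le> (\<Sum>i=1..K. \<bar>?w (8 * real i)\<bar> * g (- (8 * real i)))"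
    by (rule order_trans[OF sum_abs]) (simp add: abs_mult abs_node_weight_minus g_def)
  also have "\<dots> \<le> (16 * N) / 1890"
  proof (rule sum_far_weights)
    fix i assume "i \<in> {1..K}"
    then have "real i * 1 \<le> real i * real i"
      by (intro mult_left_mono) auto
    then have "16 * N * real i \<le> 16 * N * (real i)\<^sup>2"
      using N by (intro mult_left_mono) (auto simp: power2_eq_square)
    moreover have "g (- (8 * real i)) \<le> 16 * N * real i"
      using N by (auto simp: g_def max_def)
    ultimately show "g (- (8 * real i)) \<le> 16 * N * (real i)\<^sup>2"
      by linarith
  qed (use N in auto)
  finally have far: "\<bar>?far\<bar> \<le> (16 * N) / 1890" .
  \<comment> \<open>The node \<open>-1\<close> outweighs the rest: its bound has coefficient 1/3 in
    \<open>N\<close>, against 4/21 for the node \<open>-2\<close> and 16/1890 for the far nodes,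
    which leaves more than 1/8.\<close>
  have "\<bar>?w (-2) * (4 * N - 4)\<bar> \<le> 1 / 21 * (4 * N - 4)"
    unfolding abs_mult abs_node_weight_minus using abs_node_weight_2[of K] N
    by (intro mult_mono) auto
  moreover have "1 / 6 * (2 * N - 1) \<le> \<bar>?w (-1) * (2 * N - 1)\<bar>"
    unfolding abs_mult abs_node_weight_minus using abs_node_weight_1(2)[of K] N
    by (intro mult_mono) auto
  ultimately have "1 / 6 * (2 * N - 1) - 1 / 21 * (4 * N - 4) - 16 * N / 1890 \<le> \<bar>\<Sum>x\<in>nodes K. ?w x * g x\<bar>"
    unfolding split using far by linarith
  then show ?thesis
    unfolding eq using N by (simp add: field_simps)
qed

text \<open>The measures are the normalised positive and negative parts of
  \<open>node_weight\<close>, equal in mass because the weights sum to 0. Their difference is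
  \<open>2 / M\<close> times the weights and inherits the vanishing moments;
  \<open>M \<le> 1\<close> preserves the gap and \<open>1 / 4 \<le> M\<close> bounds the second
  moment.\<close>

lemma dual_measures:
  fixes N :: real
  assumes N: "1 \<le> N"
  obtains \<mu> \<mu>' where
    "\<And>x. 0 \<le> \<mu> x" "(\<Sum>x\<in>nodes K. \<mu> x) = 1"
    "\<And>x. 0 \<le> \<mu>' x" "(\<Sum>x\<in>nodes K. \<mu>' x) = 1"
    "\<And>k. k < 2 * K + 4 \<Longrightarrow> (\<Sum>x\<in>nodes K. (\<mu> x - \<mu>' x) * x ^ k) = 0"
    "(\<Sum>x\<in>nodes K. \<mu> x * x\<^sup>2) \<le> 4"
    "N / 2 \<le> \<bar>\<Sum>x\<in>nodes K. (\<mu> x - \<mu>' x) * \<bar>2 * N * x + x\<^sup>2\<bar>\<bar>"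
proof
  let ?w = "node_weight K"
  define M where "M = (\<Sum>x\<in>nodes K. \<bar>?w x\<bar>)"
  have M: "M \<le> 1" "1 / 4 \<le> M"
    using sum_abs_node_weight[of K] by (simp_all add: M_def)
  define \<mu> \<mu>' where "\<mu> x = (\<bar>?w x\<bar> + ?w x) / M" and "\<mu>' x = (\<bar>?w x\<bar> - ?w x) / M" for x
  have w0: "(\<Sum>x\<in>nodes K. ?w x) = 0"
    using sum_node_weight_power[of 0 K] by simp
  have diff: "(\<Sum>x\<in>nodes K. (\<mu> x - \<mu>' x) * h x) = 2 / M * (\<Sum>x\<in>nodes K. ?w x * h x)" for h
    unfolding sum_distrib_left by (intro sum.cong refl) (use M in \<open>simp add: \<mu>_def \<mu>'_def field_simps\<close>)
  show "0 \<le> \<mu> x" "0 \<le> \<mu>' x" for x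
    using M by (auto simp: \<mu>_def \<mu>'_def intro!: divide_nonneg_nonneg)
  show "(\<Sum>x\<in>nodes K. \<mu> x) = 1" "(\<Sum>x\<in>nodes K. \<mu>' x) = 1"
    using M unfolding \<mu>_def \<mu>'_def sum_divide_distrib[symmetric] sum.distrib sum_subtractf w0 M_def[symmetric]
    by simp_all
  show "(\<Sum>x\<in>nodes K. (\<mu> x - \<mu>' x) * x ^ k) = 0" if "k < 2 * K + 4" for k
    by (simp add: diff sum_node_weight_power[OF that])
  have "(\<Sum>x\<in>nodes K. \<mu> x * x\<^sup>2) = ((\<Sum>x\<in>nodes K. \<bar>?w x\<bar> * x\<^sup>2) + (\<Sum>x\<in>nodes K. ?w x * x\<^sup>2)) / M"
    by (simp add: \<mu>_def sum_divide_distrib[symmetric] sum.distrib[symmetric] algebra_simps)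
  also have "\<dots> \<le> 1 / M"
    using sum_abs_node_weight_square[of K] sum_node_weight_power[of 2 K] M by (intro divide_right_mono) auto
  also have "\<dots> \<le> 4"
    using M by (simp add: field_simps)
  finally show "(\<Sum>x\<in>nodes K. \<mu> x * x\<^sup>2) \<le> 4" .
  have "N / 2 \<le> 2 * (N / 4)"
    by simp
  also have "\<dots> \<le> 2 / M * \<bar>\<Sum>x\<in>nodes K. ?w x * \<bar>2 * N * x + x\<^sup>2\<bar>\<bar>"
    using node_weight_gap[OF N, of K] N M by (intro mult_mono) (auto simp: field_simps)
  finally show "N / 2 \<le> \<bar>\<Sum>x\<in>nodes K. (\<mu> x - \<mu>' x) * \<bar>2 * N * x + x\<^sup>2\<bar>\<bar>"
    unfolding diff abs_mult using M by simp
qed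

lemma abs_nodes_le: "x \<in> nodes K \<Longrightarrow> 1 \<le> K \<Longrightarrow> \<bar>x\<bar> \<le> 8 * real K"
  by (auto simp: nodes_def far_nodes_def)

section \<open>Concentration of the distance\<close>

text \<open>Here \<open>4 * W / (W + S)\<^sup>2\<close> is the factor turning squared amplitudes
  with sum \<open>S\<close> into probabilities. Factoring the difference and using
  \<open>S \<le> W + S\<close> leaves denominators of at least \<open>W\<^sup>2\<close>, so the
  effect on total probability is linear in \<open>S - S'\<close>.\<close>

lemma inverse_square_diff_bound:
  fixes W S S' :: real
  assumes "0 < W" "0 \<le> S" "0 \<le> S'"
  shows "\<bar>4 * W / (W + S)\<^sup>2 - 4 * W / (W + S')\<^sup>2\<bar> * S \<le> 8 * \<bar>S - S'\<bar> / W"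
proof -
  let ?a = "W + S" and ?b = "W + S'"
  have ab: "W \<le> ?a" "W \<le> ?b" "0 < ?a" "0 < ?b" using assms by auto
  have eq: "4 * W / ?a\<^sup>2 - 4 * W / ?b\<^sup>2 = 4 * W * (?b - ?a) * (1 / (?a * ?b\<^sup>2) + 1 / (?a\<^sup>2 * ?b))"
  proof -
    have "4 * W / a\<^sup>2 - 4 * W / b\<^sup>2 = 4 * W * (b - a) * (1 / (a * b\<^sup>2) + 1 / (a\<^sup>2 * b))"
      if "a \<noteq> 0" "b \<noteq> 0" for a b :: real
      using that by (simp add: field_simps power2_eq_square)
    from this[of ?a ?b] show ?thesis using ab by simp
  qed
  have "\<bar>4 * W / ?a\<^sup>2 - 4 * W / ?b\<^sup>2\<bar> = 4 * W * \<bar>S - S'\<bar> * (1 / (?a * ?b\<^sup>2) + 1 / (?a\<^sup>2 * ?b))"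
  proof -
    have "0 \<le> 1 / (?a * ?b\<^sup>2) + 1 / (?a\<^sup>2 * ?b)"
      using ab assms by (intro add_nonneg_nonneg divide_nonneg_nonneg mult_nonneg_nonneg) auto
    moreover have "\<bar>?b - ?a\<bar> = \<bar>S - S'\<bar>" by simp
    moreover have "\<bar>4 * W\<bar> = 4 * W"
      using assms(1) by simp
    ultimately show ?thesis
      unfolding eq abs_mult by (simp only: abs_of_nonneg)
  qed
  then have "\<bar>4 * W / ?a\<^sup>2 - 4 * W / ?b\<^sup>2\<bar> * S = 4 * W * \<bar>S - S'\<bar> * ((1 / (?a * ?b\<^sup>2) + 1 / (?a\<^sup>2 * ?b)) * S)"
    by simp
  also have "\<dots> \<le> 4 * W * \<bar>S - S'\<bar> * ((1 / (?a * ?b\<^sup>2) + 1 / (?a\<^sup>2 * ?b)) * ?a)"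
    using ab assms by (intro mult_left_mono) auto
  also have "(1 / (?a * ?b\<^sup>2) + 1 / (?a\<^sup>2 * ?b)) * ?a = 1 / (?b * ?b) + 1 / (?a * ?b)"
  proof -
    have "(1 / (a * b\<^sup>2) + 1 / (a\<^sup>2 * b)) * a = 1 / (b * b) + 1 / (a * b)"
      if "a \<noteq> 0" "b \<noteq> 0" for a b :: real
      using that by (simp add: field_simps power2_eq_square)
    from this[of ?a ?b] show ?thesis using ab by simp
  qed
  also have "4 * W * \<bar>S - S'\<bar> * (1 / (?b * ?b) + 1 / (?a * ?b)) \<le> 4 * W * \<bar>S - S'\<bar> * (1 / (W * W) + 1 / (W * W))"
    using ab assms by (intro mult_left_mono add_mono divide_left_mono mult_mono mult_pos_pos) auto
  also have "\<dots> = 8 * \<bar>S - S'\<bar> / W"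
    using assms by (simp add: field_simps)
  finally show ?thesis .
qed

definition amplitudes :: "real \<Rightarrow> real \<Rightarrow> (nat \<Rightarrow> real) \<Rightarrow> nat \<Rightarrow> real" where
  "amplitudes W N z a = (if a = 0 then sqrt W else N + z (a - 1))"

text \<open>The amplitude \<open>sqrt W\<close> sits on the dummy outcome \<open>0\<close>; in \<open>reference_dist\<close>, \<open>S'\<close> is the mean of
  \<open>\<Sum>i<D. (N + z i)\<^sup>2\<close>.\<close>

definition reference_dist :: "nat \<Rightarrow> real \<Rightarrow> real \<Rightarrow> real \<Rightarrow> nat \<Rightarrow> real" where
  "reference_dist D N W S' a = (let \<kappa> = 4 * W / (W + S')\<^sup>2 in if a = 0 then 1 - D * (\<kappa> * N\<^sup>2) else \<kappa> * N\<^sup>2)"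

lemma sum_amplitudes_square:
  assumes "0 \<le> W"
  shows "(\<Sum>a<Suc D. amplitudes W N z a * amplitudes W N z a) = W + (\<Sum>i<D. (N + z i)\<^sup>2)"
  unfolding sum.lessThan_Suc_shift using assms by (simp add: amplitudes_def power2_eq_square)

lemma is_distribution_reference:
  fixes N W S' :: real
  assumes W: "0 < W" "4 * D * N\<^sup>2 \<le> W" and S': "0 \<le> S'"
  shows "is_distribution (Suc D) (reference_dist D N W S')"
proof -
  have "D * (4 * W / (W + S')\<^sup>2 * N\<^sup>2) = W * (4 * D * N\<^sup>2) / (W + S')\<^sup>2"
    by (simp only: times_divide_eq_left times_divide_eq_right) (simp add: mult_ac)
  also have "\<dots> \<le> W * W / W\<^sup>2"
    using assms by (intro frac_le mult_left_mono power_mono) auto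
  also have "\<dots> = 1"
    using W by (simp add: power2_eq_square)
  finally have "D * (4 * W / (W + S')\<^sup>2 * N\<^sup>2) \<le> 1" .
  moreover have "(\<Sum>a<Suc D. reference_dist D N W S' a) = 1"
    unfolding sum.lessThan_Suc_shift by (simp add: reference_dist_def Let_def)
  ultimately show ?thesis
    using W by (auto simp: is_distribution_def reference_dist_def Let_def)
qed

text \<open>The random factor \<open>A\<close> is replaced by \<open>\<kappa>\<close> at a cost of
  \<open>\<bar>A - \<kappa>\<bar> * S\<close> on outcome 0 and again on the other outcomes;
  replacing \<open>S\<close> by \<open>S'\<close> on outcome 0 costs
  \<open>4 / W * \<bar>S - S'\<bar>\<close> more, whence 20 = 8 + 8 + 4. What remains is a constant
  for outcome 0 and a sum of one term per coordinate, to be compared with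
  \<open>\<Phi>\<close>.\<close>

lemma l1_dist_concentration:
  fixes z :: "nat \<Rightarrow> real" and N W S' \<Phi> :: real and D :: nat
  assumes W: "0 < W" and S': "0 \<le> S'"
  defines "\<kappa> \<equiv> 4 * W / (W + S')\<^sup>2"
  defines "S \<equiv> (\<Sum>i<D. (N + z i)\<^sup>2)"
  shows "\<bar>l1_dist (Suc D) (householder_dist (Suc D) (amplitudes W N z)) (reference_dist D N W S')
     - (\<kappa> * \<Phi> + \<bar>\<kappa> * (D * N\<^sup>2) - \<kappa> * S'\<bar>)\<bar>
     \<le> 4 / W * \<bar>(\<Sum>i<D. \<bar>2 * N * z i + (z i)\<^sup>2\<bar>) - \<Phi>\<bar> + 20 * \<bar>S - S'\<bar> / W"
proof -
  define A where "A = 4 * W / (W + S)\<^sup>2"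
  let ?p = "householder_dist (Suc D) (amplitudes W N z)" and ?q = "reference_dist D N W S'"
  let ?f = "\<lambda>i. \<bar>2 * N * z i + (z i)\<^sup>2\<bar>"
  have S: "0 \<le> S" by (simp add: S_def sum_nonneg)
  have \<kappa>: "0 \<le> \<kappa>" "\<kappa> \<le> 4 / W"
  proof -
    have "4 * W / (W + S')\<^sup>2 \<le> 4 * W / W\<^sup>2"
      using W S' by (intro divide_left_mono power_mono mult_pos_pos) auto
    then show "\<kappa> \<le> 4 / W" using W by (simp add: \<kappa>_def power2_eq_square)
    show "0 \<le> \<kappa>" using W by (simp add: \<kappa>_def)
  qed
  have G: "(\<Sum>k<Suc D. amplitudes W N z k * amplitudes W N z k) = W + S"
    using W by (simp only: sum_amplitudes_square S_def less_imp_le)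
  have p: "?p (Suc i) = A * (N + z i)\<^sup>2" for i
    unfolding householder_dist_def G A_def using W
    by (simp add: amplitudes_def power_divide power_mult_distrib)
  have p0: "?p 0 = 1 - A * S"
  proof -
    have "(1 - 2 * W / (W + S))\<^sup>2 = 1 - 4 * W / (W + S)\<^sup>2 * S" if "W + S \<noteq> 0"
    proof -
      have "1 - 2 * W / (W + S) = (S - W) / (W + S)"
        using that by (simp add: field_simps)
      moreover have "(S - W)\<^sup>2 = (W + S)\<^sup>2 - 4 * W * S"
        by (simp add: algebra_simps power2_eq_square)
      ultimately have "(1 - 2 * W / (W + S))\<^sup>2 = ((W + S)\<^sup>2 - 4 * W * S) / (W + S)\<^sup>2"
        by (simp only: power_divide)
      then show ?thesis
        using that by (simp only: diff_divide_distrib) simp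
    qed
    then show ?thesis
      unfolding householder_dist_def G A_def using W S by (simp add: amplitudes_def mult.assoc)
  qed
  have q: "?q (Suc i) = \<kappa> * N\<^sup>2" "?q 0 = 1 - D * (\<kappa> * N\<^sup>2)" for i
    by (simp_all add: reference_dist_def \<kappa>_def Let_def)
  have AS: "\<bar>A - \<kappa>\<bar> * S \<le> 8 * \<bar>S - S'\<bar> / W"
    unfolding A_def \<kappa>_def using W S S' by (rule inverse_square_diff_bound)
  have "\<bar>\<bar>?p (Suc i) - ?q (Suc i)\<bar> - \<kappa> * ?f i\<bar> \<le> \<bar>A - \<kappa>\<bar> * (N + z i)\<^sup>2" for i
  proof -
    have "?p (Suc i) - ?q (Suc i) = \<kappa> * (2 * N * z i + (z i)\<^sup>2) + (A - \<kappa>) * (N + z i)\<^sup>2"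
      unfolding p q by (simp add: algebra_simps power2_eq_square)
    moreover have "\<kappa> * ?f i = \<bar>\<kappa> * (2 * N * z i + (z i)\<^sup>2)\<bar>"
      using \<kappa> by (simp add: abs_mult)
    moreover have "\<bar>A - \<kappa>\<bar> * (N + z i)\<^sup>2 = \<bar>(A - \<kappa>) * (N + z i)\<^sup>2\<bar>"
      by (simp add: abs_mult)
    ultimately show ?thesis by linarith
  qed
  then have "(\<Sum>i<D. \<bar>\<bar>?p (Suc i) - ?q (Suc i)\<bar> - \<kappa> * ?f i\<bar>) \<le> (\<Sum>i<D. \<bar>A - \<kappa>\<bar> * (N + z i)\<^sup>2)"
    by (intro sum_mono)
  also have "\<dots> = \<bar>A - \<kappa>\<bar> * S"
    by (simp only: S_def sum_distrib_left)
  finally have "\<bar>\<Sum>i<D. \<bar>?p (Suc i) - ?q (Suc i)\<bar> - \<kappa> * ?f i\<bar> \<le> \<bar>A - \<kappa>\<bar> * S"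
    by (rule order_trans[OF sum_abs])
  then have 1: "\<bar>(\<Sum>i<D. \<bar>?p (Suc i) - ?q (Suc i)\<bar>) - \<kappa> * (\<Sum>i<D. ?f i)\<bar> \<le> \<bar>A - \<kappa>\<bar> * S"
    by (simp only: sum_subtractf sum_distrib_left)
  have "\<bar>A * S - \<kappa> * S'\<bar> = \<bar>(A - \<kappa>) * S + \<kappa> * (S - S')\<bar>"
    by (simp add: algebra_simps)
  also have "\<dots> \<le> \<bar>A - \<kappa>\<bar> * S + \<kappa> * \<bar>S - S'\<bar>"
    using abs_triangle_ineq[of "(A - \<kappa>) * S" "\<kappa> * (S - S')"] S \<kappa> by (simp add: abs_mult)
  also have "\<kappa> * \<bar>S - S'\<bar> \<le> 4 / W * \<bar>S - S'\<bar>"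
    using \<kappa> by (intro mult_right_mono) auto
  finally have 2: "\<bar>A * S - \<kappa> * S'\<bar> \<le> \<bar>A - \<kappa>\<bar> * S + 4 / W * \<bar>S - S'\<bar>"
    by simp
  have 3: "?p 0 - ?q 0 = (\<kappa> * (D * N\<^sup>2) - \<kappa> * S') - (A * S - \<kappa> * S')"
    unfolding p0 q by (simp add: algebra_simps)
  have "\<bar>\<kappa> * (\<Sum>i<D. ?f i) - \<kappa> * \<Phi>\<bar> = \<kappa> * \<bar>(\<Sum>i<D. ?f i) - \<Phi>\<bar>"
    using \<kappa> by (simp add: abs_mult right_diff_distrib[symmetric])
  also have "\<dots> \<le> 4 / W * \<bar>(\<Sum>i<D. ?f i) - \<Phi>\<bar>"
    using \<kappa> by (intro mult_right_mono) auto
  finally have 4: "\<bar>\<kappa> * (\<Sum>i<D. ?f i) - \<kappa> * \<Phi>\<bar> \<le> 4 / W * \<bar>(\<Sum>i<D. ?f i) - \<Phi>\<bar>" .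
  have 5: "20 * \<bar>S - S'\<bar> / W = 2 * (8 * \<bar>S - S'\<bar> / W) + 4 / W * \<bar>S - S'\<bar>"
    by (simp add: field_simps)
  have l1: "l1_dist (Suc D) ?p ?q = \<bar>?p 0 - ?q 0\<bar> + (\<Sum>i<D. \<bar>?p (Suc i) - ?q (Suc i)\<bar>)"
    unfolding l1_dist_def by (rule sum.lessThan_Suc_shift)
  have pq0: "\<bar>\<bar>?p 0 - ?q 0\<bar> - \<bar>\<kappa> * (D * N\<^sup>2) - \<kappa> * S'\<bar>\<bar> \<le> \<bar>A * S - \<kappa> * S'\<bar>"
    unfolding 3 by (rule order_trans[OF abs_triangle_ineq3]) (simp add: abs_minus_commute)
  have "\<bar>u + P - (\<phi> + b)\<bar> \<le> t + (2 * s + r)"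
    if "\<bar>u - b\<bar> \<le> v" "v \<le> q + r" "\<bar>P - f\<bar> \<le> q" "\<bar>f - \<phi>\<bar> \<le> t" "q \<le> s" for u P \<phi> b t s r v q f :: real
    using that by linarith
  from this[OF pq0 2 1 4 AS] show ?thesis
    unfolding l1 5 .
qed

lemma weighted_variance_le:
  fixes \<mu> :: "real \<Rightarrow> real"
  assumes "\<And>x. 0 \<le> \<mu> x" "(\<Sum>x\<in>S. \<mu> x) = 1" "\<And>x. x \<in> S \<Longrightarrow> \<bar>h x\<bar> \<le> b"
  shows "(\<Sum>x\<in>S. \<mu> x * (h x - (\<Sum>y\<in>S. \<mu> y * h y))\<^sup>2) \<le> b\<^sup>2"
proof -
  define m where "m = (\<Sum>y\<in>S. \<mu> y * h y)"
  have "(\<Sum>x\<in>S. \<mu> x * (h x - m)\<^sup>2) = (\<Sum>x\<in>S. \<mu> x * (h x)\<^sup>2 - 2 * m * (\<mu> x * h x) + m\<^sup>2 * \<mu> x)"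
    by (intro sum.cong refl) (simp add: algebra_simps power2_eq_square)
  also have "\<dots> = (\<Sum>x\<in>S. \<mu> x * (h x)\<^sup>2) - 2 * m * m + m\<^sup>2"
    by (simp add: sum.distrib sum_subtractf sum_distrib_left[symmetric] m_def[symmetric] assms(2))
  also have "\<dots> \<le> (\<Sum>x\<in>S. \<mu> x * (h x)\<^sup>2)"
    by (simp add: power2_eq_square)
  also have "\<dots> \<le> (\<Sum>x\<in>S. \<mu> x * b\<^sup>2)"
  proof (intro sum_mono mult_left_mono assms(1))
    fix x assume "x \<in> S"
    then show "(h x)\<^sup>2 \<le> b\<^sup>2"
      using power_mono[OF assms(3) abs_ge_zero, of x 2] by simp
  qed
  also have "\<dots> = b\<^sup>2"
    by (simp add: sum_distrib_right[symmetric] assms(2))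
  finally show ?thesis by (simp add: m_def)
qed

section \<open>The lower bound\<close>

text \<open>With the other coordinates fixed, \<open>z i\<close> becomes a complex variable in one
  entry of the reflection vector. The acceptance probability extends holomorphically, with modulus
  at most \<open>(1 + 72 * R / sqrt W) ^ (2 * T)\<close> on the disc of radius \<open>3 * R\<close>,
  and the vanishing moments leave only its Taylor tail.\<close>

lemma acceptance_moment_bound:
  fixes z :: "nat \<Rightarrow> real" and N W R :: real and which ctl :: "nat \<Rightarrow> bool"
  assumes V: "\<And>j. j \<le> T \<Longrightarrow> is_unitary (full_dim (Suc D) m K) (V j)"
    and UQ: "op_bounded (Suc D * m) 1 UQ"
    and m: "Suc D \<le> m" and i: "i < D" and W: "0 < W" and R: "0 < R" "18 * R < sqrt W"
    and S: "\<And>x. x \<in> S \<Longrightarrow> \<bar>x\<bar> \<le> R"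
    and moments: "\<And>k. k < M \<Longrightarrow> (\<Sum>x\<in>S. \<nu> x * x ^ k) = 0"
    and B: "B \<subseteq> {..<full_dim (Suc D) m K}"
  defines "Fr \<equiv> (\<lambda>z. \<Sum>r\<in>B. (cmod (alg_state (Suc D) m K V which ctl (\<lambda>_. False)
    (householder (Suc D * m) (diag_vec m (\<lambda>a. of_real (amplitudes W N z a)))) UQ T r))\<^sup>2)"
  shows "\<bar>\<Sum>x\<in>S. \<nu> x * Fr (z(i := x))\<bar> \<le> (\<Sum>x\<in>S. \<bar>\<nu> x\<bar>) * (1 + 72 * R / sqrt W) ^ (2 * T) * (3 / 2) / 3 ^ M"
proof -
  let ?n = "Suc D * m"
  define c0 where "c0 = diag_vec m (amplitudes W N (z(i := 0)))"
  define e where "e w = diag_vec m (\<lambda>a. if a = Suc i then w else 0 :: complex)" for w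
  define u where "u w = (\<lambda>r. of_real (c0 r) + e w r)" for w
  define g where "g = vnorm ?n (\<lambda>r. of_real (c0 r))"
  \<comment> \<open>72 = 24 * 3: the constant of the perturbation bound, on the disc of radius
    \<open>3 * R\<close> where Cauchy's estimate is applied.\<close>
  define L where "L = 1 + 72 * R / sqrt W"
  define \<psi> where "\<psi> w = alg_state (Suc D) m K V which ctl (\<lambda>_. False) (householder ?n (u w)) UQ T" for w
  have sW: "0 < sqrt W" using W by simp
  have L1: "1 \<le> L" using R sW by (simp add: L_def)
  have u_real: "u (of_real x) = diag_vec m (\<lambda>a. of_real (amplitudes W N (z(i := x)) a))" for x
    by (auto simp: fun_eq_iff u_def c0_def e_def diag_vec_def amplitudes_def)
  have e_norm: "vnorm ?n (e w) = cmod w" for w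
  proof -
    have "(vnorm ?n (e w))\<^sup>2 = (\<Sum>r<?n. if r mod m = r div m then (if r div m = Suc i then (cmod w)\<^sup>2 else 0) else 0)"
      unfolding vnorm_power2 by (intro sum.cong refl) (simp add: e_def diag_vec_def)
    also have "\<dots> = (cmod w)\<^sup>2"
      using sum_diag[OF m, of "\<lambda>a. if a = Suc i then (cmod w)\<^sup>2 else 0"] i by simp
    finally show ?thesis
      by (simp add: L2_set_nonneg)
  qed
  have "g\<^sup>2 = (\<Sum>a<Suc D. amplitudes W N (z(i := 0)) a * amplitudes W N (z(i := 0)) a)"
    unfolding g_def vnorm_power2 sum_diag_vec_mult[OF m, symmetric] by (simp add: c0_def power2_eq_square)
  also have "\<dots> \<ge> W"
    using W by (simp only: sum_amplitudes_square less_imp_le) (simp add: sum_nonneg)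
  finally have g: "sqrt W \<le> g"
    by (rule real_le_lsqrt[rotated -1, THEN order_trans]) (simp_all add: g_def L2_set_nonneg)
  have pert: "vdot ?n (u w) (u w) \<noteq> 0" "op_bounded ?n (1 + 24 * \<kappa>) (householder ?n (u w))"
    if "cmod w \<le> \<kappa> * sqrt W" "0 \<le> \<kappa>" "\<kappa> \<le> 1 / 6" for w \<kappa>
  proof -
    have "vnorm ?n (e w) \<le> \<kappa> * g"
      unfolding e_norm using that(1) mult_left_mono[OF g that(2)] by linarith
    moreover have "0 < g" using g sW by linarith
    ultimately show "vdot ?n (u w) (u w) \<noteq> 0" "op_bounded ?n (1 + 24 * \<kappa>) (householder ?n (u w))"
      using householder_perturbation[of c0 ?n "e w" \<kappa>] that unfolding g_def u_def by blast+
  qed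
  \<comment> \<open>The radius comes from \<open>\<kappa> \<le> 1 / 6\<close>, which keeps the
    denominator of the reflection nonzero.\<close>
  have hol: "(\<lambda>w. \<psi> w r) holomorphic_on ball 0 (sqrt W / 6)" for r
    unfolding \<psi>_def
  proof (rule holomorphic_alg_state)
    fix r s
    have "(\<lambda>w. u w r) holomorphic_on ball 0 (sqrt W / 6)" for r
      by (cases "r div m = Suc i"; cases "r mod m = r div m")
         (auto simp: u_def e_def diag_vec_def intro!: holomorphic_intros)
    moreover have "vdot ?n (u w) (u w) \<noteq> 0" if "w \<in> ball 0 (sqrt W / 6)" for w
      using that by (intro pert(1)[of w "1 / 6"]) auto
    ultimately show "(\<lambda>w. householder ?n (u w) r s) holomorphic_on ball 0 (sqrt W / 6)"
      unfolding householder_def by (intro holomorphic_intros) auto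
  qed
  have \<psi>_norm: "vnorm (full_dim (Suc D) m K) (\<psi> w) \<le> L ^ T" if "cmod w \<le> 3 * R" for w
    unfolding \<psi>_def
  proof (rule vnorm_alg_state[OF V _ _ L1])
    have "op_bounded ?n (1 + 24 * (3 * R / sqrt W)) (householder ?n (u w))"
      using that R sW by (intro pert(2)) (auto simp: field_simps)
    then show "op_bounded ?n L (householder ?n (u w))"
      by (simp add: L_def)
    show "op_bounded ?n L UQ"
      by (rule op_bounded_mono[OF UQ L1])
  qed
  \<comment> \<open>The squared modulus is not holomorphic, but \<open>\<psi> w r\<close> times the
    conjugate of \<open>\<psi> (cnj w) r\<close> is, and the two agree at real
    \<open>w\<close>.\<close>
  define F where "F w = (\<Sum>r\<in>B. \<psi> w r * (cnj \<circ> (\<lambda>w. \<psi> w r) \<circ> cnj) w)" for w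
  have F_real: "F (of_real x) = of_real (Fr (z(i := x)))" for x
    unfolding F_def Fr_def of_real_sum o_def
    by (intro sum.cong refl) (simp add: complex_norm_square \<psi>_def u_real del: of_real_power)
  have bound: "cmod (\<Sum>x\<in>S. of_real (\<nu> x) * F (of_real x)) \<le> (\<Sum>x\<in>S. \<bar>\<nu> x\<bar>) * (L ^ T * L ^ T) * (3 / 2) / 3 ^ M"
  proof (rule vanishing_moments_holomorphic_bound[OF _ R(1)])
    have "cnj ` ball 0 (sqrt W / 6) \<subseteq> ball 0 (sqrt W / 6)"
      by auto
    then have "(\<lambda>w. \<psi> w r) holomorphic_on cnj ` ball 0 (sqrt W / 6)" for r
      by (rule holomorphic_on_subset[OF hol])
    then show "F holomorphic_on ball 0 (sqrt W / 6)"
      unfolding F_def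
      by (intro holomorphic_on_sum holomorphic_on_mult hol holomorphic_on_compose_cnj_cnj) auto
    show "3 * R < sqrt W / 6" using R by simp
    fix w assume w: "cmod w \<le> 3 * R"
    have "cmod (F w) \<le> (\<Sum>r\<in>B. \<bar>cmod (\<psi> w r)\<bar> * \<bar>cmod (\<psi> (cnj w) r)\<bar>)"
      unfolding F_def by (rule order_trans[OF norm_sum]) (simp add: norm_mult)
    also have "\<dots> \<le> (\<Sum>r<full_dim (Suc D) m K. \<bar>cmod (\<psi> w r)\<bar> * \<bar>cmod (\<psi> (cnj w) r)\<bar>)"
      using B by (intro sum_mono2) auto
    also have "\<dots> \<le> vnorm (full_dim (Suc D) m K) (\<psi> w) * vnorm (full_dim (Suc D) m K) (\<psi> (cnj w))"
      by (rule L2_set_mult_ineq)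
    also have "\<dots> \<le> L ^ T * L ^ T"
      using w L1 by (intro mult_mono \<psi>_norm) (auto simp: L2_set_nonneg)
    finally show "cmod (F w) \<le> L ^ T * L ^ T" .
  qed (use S moments in auto)
  have "(\<Sum>x\<in>S. complex_of_real (\<nu> x) * F (of_real x)) = of_real (\<Sum>x\<in>S. \<nu> x * Fr (z(i := x)))"
    by (simp add: F_real)
  from bound[unfolded this] show ?thesis
    unfolding norm_of_real L_def power_add[symmetric] mult_2[symmetric] .
qed

lemma exp_le_power_3: "exp (real k) \<le> 3 ^ k"
proof -
  have "exp (real k) = exp 1 ^ k"
    by (simp add: exp_of_nat_mult[symmetric])
  also have "\<dots> \<le> 3 ^ k"
    using exp_le by (intro power_mono) auto
  finally show ?thesis .
qed

lemma adj_householder_diag: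
  "adj (householder n (diag_vec m (\<lambda>a. of_real (c a)))) = householder n (diag_vec m (\<lambda>a. of_real (c a)))"
  using adj_householder_real[of n "diag_vec m c"] by (simp add: of_real_diag_vec)

text \<open>The integer \<open>k\<close> is of order \<open>ln D\<close>: the nodes reach out to
  \<open>8 * k\<close>, the roughly \<open>2 * k\<close> matched moments beat both the growth
  \<open>3 ^ k\<close> and the \<open>D\<close> exchanges, and \<open>D\<close> large against
  \<open>k ^ 4\<close> gives concentration.\<close>

lemma query_lower_bound:
  fixes N eps :: real and D k :: nat
  assumes solves: "solves_distance_estimation (Suc D) m eps K T V which ctl dag out"
    and m: "Suc D \<le> m" and N: "1 \<le> N" and eps: "eps \<le> 1 / (240 * N)"
    and k: "1 \<le> k" "real D \<le> 3 ^ k" "2 * 10 ^ 12 * real k ^ 4 \<le> real D"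
  shows "N * sqrt D / 576 < T"
proof (rule ccontr)
  assume "\<not> N * sqrt D / 576 < T"
  then have T: "real T \<le> N * sqrt D / 576" by simp

  \<comment> \<open>Parameters, the two measures and their statistics\<close>
  define n where "n = full_dim (Suc D) m K"
  \<comment> \<open>Large enough for \<open>reference_dist\<close> to be a distribution, yet
    comparable to \<open>S' \<le> 10 * D * N\<^sup>2\<close>, so that a constant fraction of the
    reference mass lies on the informative outcomes.\<close>
  define W where "W = 4 * D * N\<^sup>2"
  obtain \<mu> \<mu>' where \<mu>: "\<And>x. 0 \<le> \<mu> x" "(\<Sum>x\<in>nodes k. \<mu> x) = 1"
    and \<mu>': "\<And>x. 0 \<le> \<mu>' x" "(\<Sum>x\<in>nodes k. \<mu>' x) = 1"
    and moments: "\<And>j. j < 2 * k + 4 \<Longrightarrow> (\<Sum>x\<in>nodes k. (\<mu> x - \<mu>' x) * x ^ j) = 0"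
    and second: "(\<Sum>x\<in>nodes k. \<mu> x * x\<^sup>2) \<le> 4"
    and gap: "N / 2 \<le> \<bar>\<Sum>x\<in>nodes k. (\<mu> x - \<mu>' x) * \<bar>2 * N * x + x\<^sup>2\<bar>\<bar>"
    by (rule dual_measures[OF N, of k], rule that)
  have k1: "1 \<le> real k ^ 4" using k(1) by simp
  have k3: "2000000000000 * real k ^ 4 \<le> real D" using k(3) by simp
  then have D0: "0 < D" using k1 by (cases D) auto
  have W: "0 < W" using D0 N by (simp add: W_def)
  have sqrtW: "sqrt W = 2 * N * sqrt D"
    using N by (simp add: W_def real_sqrt_mult)
  have "(100 * real k)\<^sup>2 = 10000 * real k ^ 2"
    by (simp add: power_mult_distrib)
  also have "\<dots> \<le> 10000 * real k ^ 4"
    using k(1) by (intro mult_left_mono power_increasing) auto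
  also have "\<dots> \<le> D" using k3 k1 by linarith
  finally have sqrtD: "100 * real k \<le> sqrt D"
    by (rule real_le_rsqrt)
  have sqrtD0: "0 < sqrt D" using D0 by simp
  \<comment> \<open>This is \<open>(N + x)\<^sup>2 - N\<^sup>2\<close>, the shift of a squared
    amplitude. Its mean is the same under both measures; only that of its absolute value
    differs.\<close>
  define h where "h x = 2 * N * x + x\<^sup>2" for x
  define hm where "hm = (\<Sum>x\<in>nodes k. \<mu> x * h x)"
  define S' where "S' = D * (N\<^sup>2 + hm)"
  define \<kappa> where "\<kappa> = 4 * W / (W + S')\<^sup>2"
  define f where "f \<nu> = (\<Sum>x\<in>nodes k. \<nu> x * \<bar>h x\<bar>)" for \<nu> :: "real \<Rightarrow> real"
  define ctr where "ctr \<nu> = \<kappa> * (D * f \<nu>) + \<bar>\<kappa> * (D * N\<^sup>2) - \<kappa> * S'\<bar>" for \<nu>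
  define X where "X \<nu> z = (\<Sum>i<D. \<bar>h (z i)\<bar> - f \<nu>)" for \<nu> z
  define Y where "Y z = (\<Sum>i<D. h (z i) - hm)" for z :: "nat \<Rightarrow> real"
  \<comment> \<open>The deviation allowed for \<open>X\<close> and \<open>Y\<close>, chosen so that
    \<open>24 * a / W = 1 / (480 * N)\<close>.\<close>
  define a where "a = D * N / 2880"
  define b where "b = 80 * N * (real k)\<^sup>2"
  have a0: "0 < a" using D0 N by (simp add: a_def)
  have hm': "(\<Sum>x\<in>nodes k. \<mu>' x * h x) = hm"
  proof -
    have "(\<Sum>x\<in>nodes k. (\<mu> x - \<mu>' x) * h x) =
        2 * N * (\<Sum>x\<in>nodes k. (\<mu> x - \<mu>' x) * x ^ 1) + (\<Sum>x\<in>nodes k. (\<mu> x - \<mu>' x) * x ^ 2)"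
      unfolding sum_distrib_left sum.distrib[symmetric]
      by (intro sum.cong refl) (simp add: h_def algebra_simps)
    also have "\<dots> = 0" using moments[of 1] moments[of 2] by simp
    finally show ?thesis
      by (simp add: hm_def left_diff_distrib sum_subtractf)
  qed
  have S': "0 \<le> S'" "S' \<le> 10 * D * N\<^sup>2"
  proof -
    have eq: "N\<^sup>2 + hm = (\<Sum>x\<in>nodes k. \<mu> x * (N + x)\<^sup>2)"
    proof -
      have "(\<Sum>x\<in>nodes k. \<mu> x * (N + x)\<^sup>2) = (\<Sum>x\<in>nodes k. N\<^sup>2 * \<mu> x + \<mu> x * h x)"
        by (intro sum.cong refl) (simp add: h_def algebra_simps power2_eq_square)
      then show ?thesis
        by (simp add: sum.distrib sum_distrib_left[symmetric] \<mu>(2) hm_def)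
    qed
    then show "0 \<le> S'"
      unfolding S'_def by (auto intro!: mult_nonneg_nonneg sum_nonneg \<mu>)
    have "(\<Sum>x\<in>nodes k. \<mu> x * (N + x)\<^sup>2) \<le> (\<Sum>x\<in>nodes k. 2 * N\<^sup>2 * \<mu> x + 2 * (\<mu> x * x\<^sup>2))"
    proof (rule sum_mono)
      fix x
      have "(N + x)\<^sup>2 \<le> 2 * N\<^sup>2 + 2 * x\<^sup>2"
        using zero_le_power2[of "N - x"] by (simp add: power2_eq_square algebra_simps)
      then have "\<mu> x * (N + x)\<^sup>2 \<le> \<mu> x * (2 * N\<^sup>2 + 2 * x\<^sup>2)"
        by (intro mult_left_mono \<mu>)
      then show "\<mu> x * (N + x)\<^sup>2 \<le> 2 * N\<^sup>2 * \<mu> x + 2 * (\<mu> x * x\<^sup>2)"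
        by (simp add: algebra_simps)
    qed
    also have "\<dots> \<le> 2 * N\<^sup>2 + 8"
      using second by (simp add: sum.distrib sum_distrib_left[symmetric] \<mu>(2))
    also have "\<dots> \<le> 10 * N\<^sup>2"
      using N by simp
    finally have "D * (N\<^sup>2 + hm) \<le> D * (10 * N\<^sup>2)"
      unfolding eq by (intro mult_left_mono) auto
    then show "S' \<le> 10 * D * N\<^sup>2" by (simp add: S'_def)
  qed

  \<comment> \<open>The oracle pair and the guarantee of the estimator on it\<close>
  define q where "q = reference_dist D N W S'"
  have "is_distribution (Suc D) q"
    unfolding q_def using W S' by (intro is_distribution_reference) (auto simp: W_def)
  then obtain cq where cq: "(\<Sum>k<Suc D. cq k * cq k) \<noteq> 0" "\<And>a. a < Suc D \<Longrightarrow> householder_dist (Suc D) cq a = q a"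
    using householder_dist_surj[of "Suc D" q] by blast
  define UQ where "UQ = householder (Suc D * m) (diag_vec m (\<lambda>a. complex_of_real (cq a)))"
  define UP where "UP z = householder (Suc D * m) (diag_vec m (\<lambda>a. complex_of_real (amplitudes W N z a)))" for z
  define p where "p z = householder_dist (Suc D) (amplitudes W N z)" for z
  define dist where "dist z = l1_dist (Suc D) (p z) q" for z
  define st where "st z = alg_state (Suc D) m K V which ctl (\<lambda>_. False) (UP z) UQ T" for z
  have amp: "(\<Sum>k<Suc D. amplitudes W N z k * amplitudes W N z k) \<noteq> 0" for z
  proof -
    have "0 \<le> (\<Sum>i<D. (N + z i)\<^sup>2)" by (intro sum_nonneg) auto
    then show ?thesis
      using W by (simp only: sum_amplitudes_square less_imp_le)
  qed
  have V: "\<And>j. j \<le> T \<Longrightarrow> is_unitary (full_dim (Suc D) m K) (V j)"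
    using solves by (auto simp: solves_distance_estimation_def)
  have oP: "purified_oracle (Suc D) m (p z) (UP z)" for z
    unfolding p_def UP_def using m amp by (intro purified_oracle_householder) auto
  have oQ: "purified_oracle (Suc D) m (householder_dist (Suc D) cq) UQ"
    unfolding UQ_def using m cq by (intro purified_oracle_householder) auto
  have bP: "op_bounded (Suc D * m) 1 (UP z)" for z
    using oP[of z] by (intro op_bounded_unitary) (simp add: purified_oracle_def)
  have bQ: "op_bounded (Suc D * m) 1 UQ"
    using oQ by (intro op_bounded_unitary) (simp add: purified_oracle_def)
  have norm_st: "(\<Sum>r<n. (cmod (st z r))\<^sup>2) \<le> 1" for z
  proof -
    have "vnorm n (st z) \<le> 1 ^ T"
      unfolding st_def n_def by (rule vnorm_alg_state[OF V bP bQ]) auto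
    then show ?thesis
      unfolding vnorm_power2[symmetric] by (simp add: L2_set_nonneg power_le_one)
  qed
  have succ: "2 / 3 \<le> (\<Sum>r<n. if \<bar>out r - dist z\<bar> \<le> eps then (cmod (st z r))\<^sup>2 else 0)" for z
  proof -
    have "success_prob (Suc D) m K T V which ctl dag out eps (p z) (householder_dist (Suc D) cq) (UP z) UQ \<ge> 2/3"
      using solves oP[of z] oQ is_distribution_householder[OF _ amp[of z]] is_distribution_householder[OF _ cq(1)]
      unfolding solves_distance_estimation_def p_def by blast
    moreover have "l1_dist (Suc D) (p z) (householder_dist (Suc D) cq) = dist z"
      unfolding l1_dist_def dist_def by (intro sum.cong refl) (simp add: cq(2))
    moreover have "alg_state (Suc D) m K V which ctl dag (UP z) UQ T = st z"
      unfolding st_def UP_def UQ_def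
      by (intro alg_state_self_adjoint adj_householder_diag)
    ultimately show ?thesis
      by (simp only: success_prob_def n_def)
  qed

  \<comment> \<open>Concentration of the distance around two separated centres\<close>
  have conc: "\<bar>dist z - ctr \<nu>\<bar> \<le> 1 / (480 * N)" if "(X \<nu> z)\<^sup>2 + (Y z)\<^sup>2 < a\<^sup>2" for \<nu> z
  proof -
    have "(X \<nu> z)\<^sup>2 \<le> a\<^sup>2" "(Y z)\<^sup>2 \<le> a\<^sup>2"
      using that zero_le_power2[of "X \<nu> z"] zero_le_power2[of "Y z"] by linarith+
    then have XY: "\<bar>X \<nu> z\<bar> \<le> a" "\<bar>Y z\<bar> \<le> a"
      using a0 by (simp_all add: abs_le_square_iff[symmetric])
    have "(\<Sum>i<D. (N + z i)\<^sup>2) = (\<Sum>i<D. N\<^sup>2 + h (z i))"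
      by (intro sum.cong refl) (simp add: h_def algebra_simps power2_eq_square)
    then have YS: "(\<Sum>i<D. (N + z i)\<^sup>2) - S' = Y z"
      by (simp add: Y_def S'_def sum.distrib sum_subtractf algebra_simps)
    have XS: "(\<Sum>i<D. \<bar>2 * N * z i + (z i)\<^sup>2\<bar>) - D * f \<nu> = X \<nu> z"
      by (simp add: X_def h_def sum_subtractf)
    have "\<bar>dist z - ctr \<nu>\<bar> \<le> 4 / W * \<bar>X \<nu> z\<bar> + 20 * \<bar>Y z\<bar> / W"
      using l1_dist_concentration[OF W S'(1), of D N z "D * f \<nu>"]
      unfolding XS YS ctr_def dist_def p_def q_def \<kappa>_def .
    also have "\<dots> \<le> 4 / W * a + 20 * a / W"
      using XY W by (intro add_mono mult_left_mono divide_right_mono) auto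
    also have "\<dots> = 1 / (480 * N)"
      using D0 N by (simp add: a_def W_def field_simps power2_eq_square)
    finally show ?thesis .
  qed
  have \<kappa>0: "0 \<le> \<kappa>"
    using W by (simp add: \<kappa>_def)
  \<comment> \<open>Since \<open>W + S' \<le> 14 * D * N\<^sup>2\<close>, the gap is at least 16/196
    times \<open>1 / (2 * N)\<close>, that is \<open>4 / (98 * N)\<close>.\<close>
  have ctr_gap: "4 / (100 * N) \<le> \<bar>ctr \<mu> - ctr \<mu>'\<bar>"
  proof -
    have "4 / (100 * N) \<le> (16 * D * N\<^sup>2 / (14 * D * N\<^sup>2)\<^sup>2) * (D * (N / 2))"
      using D0 N by (simp add: field_simps power2_eq_square)
    also have "\<dots> \<le> \<kappa> * (D * (N / 2))"
    proof (rule mult_right_mono)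
      have "0 < W + S'" "W + S' \<le> 14 * D * N\<^sup>2"
        using W S' by (simp_all add: W_def)
      then have "4 * W / (14 * D * N\<^sup>2)\<^sup>2 \<le> 4 * W / (W + S')\<^sup>2"
        using W D0 N by (intro divide_left_mono power_mono mult_pos_pos zero_less_power) auto
      then show "16 * D * N\<^sup>2 / (14 * D * N\<^sup>2)\<^sup>2 \<le> \<kappa>"
        by (simp add: \<kappa>_def W_def)
    qed (use N in simp)
    also have "\<kappa> * (D * (N / 2)) \<le> \<kappa> * (D * \<bar>f \<mu> - f \<mu>'\<bar>)"
      using gap W unfolding f_def \<kappa>_def h_def
      by (intro mult_left_mono) (auto simp: left_diff_distrib sum_subtractf)
    also have "\<dots> = \<bar>\<kappa> * (D * (f \<mu> - f \<mu>'))\<bar>"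
      using \<kappa>0 by (simp add: abs_mult)
    also have "\<kappa> * (D * (f \<mu> - f \<mu>')) = ctr \<mu> - ctr \<mu>'"
      by (simp add: ctr_def algebra_simps)
    finally show ?thesis .
  qed

  \<comment> \<open>An acceptance test separating the two centres\<close>
  define B where "B = {r. r < n \<and> \<bar>out r - ctr \<mu>\<bar> \<le> eps + 1 / (480 * N)}"
  define Fr where "Fr z = (\<Sum>r\<in>B. (cmod (st z r))\<^sup>2)" for z
  have Fr_eq: "Fr z = (\<Sum>r<n. if r \<in> B then (cmod (st z r))\<^sup>2 else 0)" for z
    unfolding Fr_def by (subst sum.inter_restrict[symmetric]) (auto simp: B_def intro!: sum.cong)
  have Fr0: "0 \<le> Fr z" for z by (simp add: Fr_def sum_nonneg)
  \<comment> \<open>A quadratic majorant of the indicator of the bad event, as in Chebyshev's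
    inequality: it is at least 1 wherever concentration may fail. This allows \<open>Fr\<close> to
    be bounded pointwise before expectations are taken.\<close>
  define bad where "bad \<nu> z = 1 / a\<^sup>2 * ((X \<nu> z)\<^sup>2 + (Y z)\<^sup>2)" for \<nu> z
  have bad: "(X \<nu> z)\<^sup>2 + (Y z)\<^sup>2 < a\<^sup>2" if "bad \<nu> z < 1" for \<nu> z
    using that a0 by (simp add: bad_def field_simps)
  have low: "2 / 3 + (- 1) * bad \<mu> z \<le> Fr z" for z
  proof (cases "bad \<mu> z < 1")
    case True
    have "(\<Sum>r<n. if \<bar>out r - dist z\<bar> \<le> eps then (cmod (st z r))\<^sup>2 else 0) \<le> Fr z"
      unfolding Fr_eq using conc[OF bad[OF True]] by (intro sum_mono) (auto simp: B_def)
    moreover have "0 \<le> bad \<mu> z" by (simp add: bad_def)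
    ultimately show ?thesis using succ[of z] by linarith
  next
    case False
    then show ?thesis using Fr0[of z] by linarith
  qed
  have high: "Fr z \<le> 1 / 3 + bad \<mu>' z" for z
  proof (cases "bad \<mu>' z < 1")
    case True
    \<comment> \<open>An output in \<open>B\<close> within \<open>eps\<close> of
      \<open>dist z\<close> would bring the centres within \<open>3 / (240 * N)\<close> of each
      other, less than their gap.\<close>
    have far: "\<not> \<bar>out r - dist z\<bar> \<le> eps" if "r \<in> B" for r
    proof
      assume "\<bar>out r - dist z\<bar> \<le> eps"
      moreover have "\<bar>out r - ctr \<mu>\<bar> \<le> eps + 1 / (480 * N)"
        using that by (simp add: B_def)
      moreover have "\<bar>dist z - ctr \<mu>'\<bar> \<le> 1 / (480 * N)"
        by (rule conc[OF bad[OF True]])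
      ultimately have "\<bar>ctr \<mu> - ctr \<mu>'\<bar> \<le> 2 * eps + 2 * (1 / (480 * N))"
        by linarith
      also have "\<dots> \<le> 2 * (1 / (240 * N)) + 2 * (1 / (480 * N))"
        using eps by simp
      also have "\<dots> < 4 / (100 * N)"
        using N by (simp add: field_simps)
      finally show False using ctr_gap by simp
    qed
    have "Fr z + (\<Sum>r<n. if \<bar>out r - dist z\<bar> \<le> eps then (cmod (st z r))\<^sup>2 else 0) \<le> (\<Sum>r<n. (cmod (st z r))\<^sup>2)"
      unfolding Fr_eq sum.distrib[symmetric] using far by (intro sum_mono) auto
    moreover have "0 \<le> bad \<mu>' z" by (simp add: bad_def)
    ultimately show ?thesis using succ[of z] norm_st[of z] by linarith
  next
    case False
    have "Fr z \<le> (\<Sum>r<n. (cmod (st z r))\<^sup>2)"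
      unfolding Fr_eq by (intro sum_mono) auto
    then show ?thesis using norm_st[of z] False by linarith
  qed

  \<comment> \<open>Second-moment bound for the bad event\<close>
  have h_le: "\<bar>h x\<bar> \<le> b" if "x \<in> nodes k" for x
  proof -
    have x: "\<bar>x\<bar> \<le> 8 * real k" by (rule abs_nodes_le[OF that k(1)])
    have "\<bar>h x\<bar> \<le> 2 * N * \<bar>x\<bar> + \<bar>x\<bar>\<^sup>2"
      unfolding h_def using N by (intro order_trans[OF abs_triangle_ineq]) (simp add: abs_mult)
    also have "\<dots> \<le> 2 * N * (8 * real k) + (8 * real k)\<^sup>2"
      using x N by (intro add_mono mult_left_mono power_mono) auto
    also have "\<dots> \<le> 16 * N * (real k)\<^sup>2 + 64 * N * (real k)\<^sup>2"
    proof (rule add_mono)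
      have "real k * 1 \<le> real k * real k"
        using k(1) by (intro mult_left_mono) auto
      then show "2 * N * (8 * real k) \<le> 16 * N * (real k)\<^sup>2"
        using N by (simp add: power2_eq_square)
      show "(8 * real k)\<^sup>2 \<le> 64 * N * (real k)\<^sup>2"
        using N by (simp add: power_mult_distrib mult_right_mono)
    qed
    finally show ?thesis by (simp add: b_def)
  qed
  \<comment> \<open>The constant \<open>2 * 10 ^ 12\<close> in the hypothesis on \<open>D\<close> is
    spent here, with 12800 = 2 * 80 * 80.\<close>
  have "1 / a\<^sup>2 * (2 * (D * b\<^sup>2)) = 12800 * 2880\<^sup>2 * real k ^ 4 / D"
    unfolding a_def b_def using D0 N
    by (simp add: power2_eq_square power4_eq_xxxx field_simps)
  also have "\<dots> \<le> 1 / 10"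
    using k3 D0 by (simp add: field_simps)
  finally have b_small: "1 / a\<^sup>2 * (2 * (D * b\<^sup>2)) \<le> 1 / 10" .
  have bad_expect: "prod_expect (nodes k) \<nu> D (bad \<nu>) \<le> 1 / 10"
    if \<nu>: "\<And>x. 0 \<le> \<nu> x" "(\<Sum>x\<in>nodes k. \<nu> x) = 1" "(\<Sum>x\<in>nodes k. \<nu> x * h x) = hm" for \<nu>
  proof -
    have 1: "prod_expect (nodes k) \<nu> D (\<lambda>z. (X \<nu> z)\<^sup>2) \<le> D * b\<^sup>2"
    proof -
      have "(\<Sum>x\<in>nodes k. \<nu> x * (\<bar>h x\<bar> - f \<nu>)) = 0"
        by (simp add: right_diff_distrib sum_subtractf sum_distrib_right[symmetric] \<nu>(2) f_def)
      from prod_expect_sum_square[OF \<nu>(2) this, of D]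
      have "prod_expect (nodes k) \<nu> D (\<lambda>z. (X \<nu> z)\<^sup>2) = D * (\<Sum>x\<in>nodes k. \<nu> x * (\<bar>h x\<bar> - f \<nu>)\<^sup>2)"
        unfolding X_def .
      also have "\<dots> \<le> D * b\<^sup>2"
        unfolding f_def using h_le \<nu> by (intro mult_left_mono weighted_variance_le) auto
      finally show ?thesis .
    qed
    have 2: "prod_expect (nodes k) \<nu> D (\<lambda>z. (Y z)\<^sup>2) \<le> D * b\<^sup>2"
    proof -
      have "(\<Sum>x\<in>nodes k. \<nu> x * (h x - hm)) = 0"
        by (simp add: right_diff_distrib sum_subtractf sum_distrib_right[symmetric] \<nu>(2,3))
      from prod_expect_sum_square[OF \<nu>(2) this, of D]
      have "prod_expect (nodes k) \<nu> D (\<lambda>z. (Y z)\<^sup>2) = D * (\<Sum>x\<in>nodes k. \<nu> x * (h x - hm)\<^sup>2)"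
        unfolding Y_def .
      also have "\<dots> \<le> D * b\<^sup>2"
        unfolding \<nu>(3)[symmetric] using h_le \<nu>(1,2) by (intro mult_left_mono weighted_variance_le) auto
      finally show ?thesis .
    qed
    have "prod_expect (nodes k) \<nu> D (bad \<nu>) = 1 / a\<^sup>2 *
        (prod_expect (nodes k) \<nu> D (\<lambda>z. (X \<nu> z)\<^sup>2) + prod_expect (nodes k) \<nu> D (\<lambda>z. (Y z)\<^sup>2))"
      unfolding bad_def prod_expect_mult prod_expect_add ..
    also have "\<dots> \<le> 1 / a\<^sup>2 * (2 * (D * b\<^sup>2))"
      using 1 2 by (intro mult_left_mono) auto
    finally show ?thesis using b_small by linarith
  qed
  have "2 / 3 + (- 1) * prod_expect (nodes k) \<mu> D (bad \<mu>) = prod_expect (nodes k) \<mu> D (\<lambda>z. 2 / 3 + (- 1) * bad \<mu> z)"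
    by (simp only: prod_expect_add prod_expect_mult prod_expect_const[OF \<mu>(2)])
  also have "\<dots> \<le> prod_expect (nodes k) \<mu> D Fr"
    using low by (intro prod_expect_mono \<mu>)
  finally have E0: "2 / 3 - 1 / 10 \<le> prod_expect (nodes k) \<mu> D Fr"
    using bad_expect[OF \<mu> hm_def[symmetric]] by linarith
  have "prod_expect (nodes k) \<mu>' D Fr \<le> prod_expect (nodes k) \<mu>' D (\<lambda>z. 1 / 3 + bad \<mu>' z)"
    using high by (intro prod_expect_mono \<mu>')
  also have "\<dots> = 1 / 3 + prod_expect (nodes k) \<mu>' D (bad \<mu>')"
    by (simp only: prod_expect_add prod_expect_const[OF \<mu>'(2)])
  finally have E1: "prod_expect (nodes k) \<mu>' D Fr \<le> 1 / 3 + 1 / 10"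
    using bad_expect[OF \<mu>' hm'] by linarith

  \<comment> \<open>Exchanging the two measures coordinate by coordinate\<close>
  have total: "(\<Sum>x\<in>nodes k. \<bar>\<mu> x - \<mu>' x\<bar>) \<le> 2"
  proof -
    have "(\<Sum>x\<in>nodes k. \<bar>\<mu> x - \<mu>' x\<bar>) \<le> (\<Sum>x\<in>nodes k. \<mu> x + \<mu>' x)"
      using \<mu>(1) \<mu>'(1) by (intro sum_mono) (smt (verit))
    then show ?thesis by (simp add: sum.distrib \<mu> \<mu>')
  qed
  \<comment> \<open>This fixes the constant 576 = 2 * 288: the assumed bound on \<open>T\<close>
    makes the exponent \<open>2 * T * 288 * k / (N * sqrt D)\<close> at most
    \<open>k\<close>.\<close>
  have growth: "(1 + 72 * (8 * real k) / sqrt W) ^ (2 * T) \<le> 3 ^ k"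
  proof -
    let ?x = "72 * (8 * real k) / sqrt W"
    have x: "?x = 288 * real k / (N * sqrt D)"
      unfolding sqrtW by simp
    have "real (2 * T) * ?x \<le> 2 * (N * sqrt D / 576) * (288 * real k / (N * sqrt D))"
      unfolding x using T N sqrtD0 by (intro mult_right_mono) auto
    also have "\<dots> = real k"
      using N sqrtD0 by (simp add: field_simps)
    finally have le: "real (2 * T) * ?x \<le> real k" .
    have "(1 + ?x) ^ (2 * T) \<le> exp ?x ^ (2 * T)"
      using W exp_ge_add_one_self[of ?x] by (intro power_mono) auto
    also have "\<dots> = exp (real (2 * T) * ?x)"
      by (rule exp_of_nat_mult[symmetric])
    also have "\<dots> \<le> exp (real k)" using le by simp
    also have "\<dots> \<le> 3 ^ k" by (rule exp_le_power_3)
    finally show ?thesis .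
  qed
  \<comment> \<open>Over \<open>D \<le> 3 ^ k\<close> coordinates this totals at most 1/27, whereas
    the acceptance probabilities differ by at least (2/3 - 1/10) - (1/3 + 1/10) = 2/15.\<close>
  have "\<bar>\<Sum>x\<in>nodes k. (\<mu> x - \<mu>' x) * Fr (z(i := x))\<bar> \<le> 1 / (27 * 3 ^ k)" if "i < D" for i z
  proof -
    have "\<bar>\<Sum>x\<in>nodes k. (\<mu> x - \<mu>' x) * Fr (z(i := x))\<bar> \<le>
        (\<Sum>x\<in>nodes k. \<bar>\<mu> x - \<mu>' x\<bar>) * (1 + 72 * (8 * real k) / sqrt W) ^ (2 * T) * (3 / 2) / 3 ^ (2 * k + 4)"
      unfolding Fr_def st_def UP_def
    proof (rule acceptance_moment_bound[OF V bQ m that W])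
      show "18 * (8 * real k) < sqrt W"
      proof -
        have "1 * (100 * real k) \<le> N * sqrt D"
          using N sqrtD by (intro mult_mono) auto
        then show ?thesis unfolding sqrtW using k(1) by simp
      qed
      show "B \<subseteq> {..<full_dim (Suc D) m K}" by (auto simp: B_def n_def)
    qed (use k(1) abs_nodes_le moments in auto)
    also have "\<dots> \<le> 2 * 3 ^ k * (3 / 2) / 3 ^ (2 * k + 4)"
      using total growth W by (intro divide_right_mono mult_right_mono mult_mono) (auto intro!: zero_le_power add_nonneg_nonneg)
    also have "\<dots> = 1 / (27 * 3 ^ k)"
    proof -
      have 1: "(3::real) ^ (2 * k + 4) = 3 ^ k * 3 ^ k * 3 ^ 4"
        by (simp only: power_add mult_2)
      have 2: "2 * t * (3 / 2) / (t * t * 3 ^ 4) = 1 / (27 * t)" if "t \<noteq> 0" for t :: real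
        using that by simp
      show ?thesis
        unfolding 1 by (rule 2) simp
    qed
    finally show ?thesis .
  qed
  then have "\<bar>prod_expect (nodes k) \<mu> D Fr - prod_expect (nodes k) \<mu>' D Fr\<bar> \<le> D * (1 / (27 * 3 ^ k))"
    by (intro prod_expect_hybrid \<mu> \<mu>')
  also have "\<dots> \<le> 1 / 27"
    using k(2) by (simp add: field_simps)
  finally show False using E0 E1 by linarith
qed

theorem theorem2p8:
  shows "\<exists>c>0. \<exists>eps0>0. \<exists>d0::nat. \<forall>d m K T V which ctrl dag out (eps::real).
           d0 \<le> d \<longrightarrow> d \<le> m \<longrightarrow> 0 < eps \<longrightarrow> eps < eps0 \<longrightarrow>
           solves_distance_estimation d m eps K T V which ctrl dag out \<longrightarrow>
           real T \<ge> c * sqrt (real d) / (eps * sqrt (ln (real d / eps)))"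
proof -
  \<comment> \<open>Provides the concentration hypothesis of \<open>query_lower_bound\<close> for
    \<open>k \<le> ln d + 1\<close> and \<open>D = d - 1\<close>.\<close>
  have "eventually (\<lambda>x::real. 2 * 10 ^ 12 * (ln x + 1) ^ 4 \<le> x - 1) at_top"
    by real_asymp
  then have "eventually (\<lambda>d::nat. 2 * 10 ^ 12 * (ln (real d) + 1) ^ 4 \<le> real d - 1) sequentially"
    by (rule eventually_compose_filterlim[OF _ filterlim_real_sequentially])
  then obtain d1 :: nat where d1: "\<And>d. d1 \<le> d \<Longrightarrow> 2 * 10 ^ 12 * (ln (real d) + 1) ^ 4 \<le> real d - 1"
    by (auto simp: eventually_at_top_linorder)
  have main: "real T \<ge> 1 / 276480 * sqrt (real d) / (eps * sqrt (ln (real d / eps)))"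
    if d: "max 3 d1 \<le> d" and m: "d \<le> m" and eps: "0 < eps" "eps < 1 / 240"
      and solves: "solves_distance_estimation d m eps K T V which ctrl dag out"
    for d m K T V which ctrl dag out and eps :: real
  proof -
    \<comment> \<open>One of the \<open>d\<close> outcomes is the dummy.\<close>
    define D where "D = d - 1"
    define k where "k = nat \<lceil>ln (real d)\<rceil>"
    \<comment> \<open>The largest \<open>N\<close> allowed by
      \<open>eps \<le> 1 / (240 * N)\<close>; it exceeds 1 because
      \<open>eps < 1 / 240\<close>.\<close>
    define N where "N = 1 / (240 * eps)"
    have dD: "d = Suc D" using d by (simp add: D_def)
    have "exp 1 \<le> real d" using exp_le d by linarith
    then have ln1: "1 \<le> ln (real d)" using d by (subst ln_ge_iff) auto
    have k_ge: "ln (real d) \<le> k" and k_le: "k \<le> ln (real d) + 1"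
      using ln1 by (simp_all add: k_def)
    have "1 \<le> k" using k_ge ln1 by linarith
    moreover have "real D \<le> 3 ^ k"
    proof -
      have "real D \<le> real d" by (simp add: dD)
      also have "\<dots> = exp (ln (real d))" using d by simp
      also have "\<dots> \<le> exp (real k)" using k_ge by simp
      also have "\<dots> \<le> 3 ^ k" by (rule exp_le_power_3)
      finally show ?thesis .
    qed
    moreover have "2 * 10 ^ 12 * real k ^ 4 \<le> real D"
    proof -
      have "2 * 10 ^ 12 * real k ^ 4 \<le> 2 * 10 ^ 12 * (ln (real d) + 1) ^ 4"
        using k_le by (intro mult_left_mono power_mono) auto
      also have "\<dots> \<le> real D" using d1[of d] d by (simp add: dD)
      finally show ?thesis .
    qed
    ultimately have "N * sqrt D / 576 < T"
      using solves m eps unfolding dD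
      by (intro query_lower_bound[where eps = eps]) (auto simp: N_def field_simps)
    moreover have "sqrt (real d) / 2 \<le> sqrt D"
    proof -
      have "sqrt (real d / 4) \<le> sqrt D" using d by (simp add: dD)
      then show ?thesis by (simp add: real_sqrt_divide)
    qed
    then have "N * (sqrt (real d) / 2) \<le> N * sqrt D"
      using eps by (intro mult_left_mono) (auto simp: N_def)
    \<comment> \<open>276480 = 240 * 576 * 2, the last factor coming from
      \<open>sqrt d / 2 \<le> sqrt D\<close>.\<close>
    ultimately have T: "1 / 276480 * sqrt (real d) / eps \<le> real T"
      by (simp add: N_def field_simps)
    \<comment> \<open>For \<open>d \<ge> 3\<close> the logarithm is at least 1, so dividing by its
      root only weakens the bound on \<open>T\<close>.\<close>
    have "ln (real d) \<le> ln (real d / eps)"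
      using d eps by (subst ln_le_cancel_iff) (auto simp: field_simps)
    then have "1 \<le> sqrt (ln (real d / eps))" using ln1 by simp
    then have "eps * 1 \<le> eps * sqrt (ln (real d / eps))"
      using eps by (intro mult_left_mono) auto
    then have "1 / 276480 * sqrt (real d) / (eps * sqrt (ln (real d / eps))) \<le> 1 / 276480 * sqrt (real d) / eps"
      using eps by (intro divide_left_mono) auto
    then show ?thesis using T by linarith
  qed
  show ?thesis
    by (rule exI[of _ "1 / 276480"], rule conjI, simp, rule exI[of _ "1 / 240"], rule conjI, simp,
        rule exI[of _ "max 3 d1"]) (use main in blast)
qed

end
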